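(* Let $\varphi$ be a symmetric absolute normalized norm on $\mathbb R^2$. Then the pinning threshold $\alpha_\varphi$ is given by $$\alpha_\varphi=\frac{4}{\varphi(1,1)}=\max\Lambda^\varphi.$$
   Context: A norm $\varphi$ on $\mathbb R^2$ is absolute if $\varphi(\mathbf x)$ depends only on $|x_1|,|x_2|$; symmetric if $\varphi(x_1,x_2)=\varphi(x_2,x_1)$; normalized if $\varphi(1,0)=\varphi(0,1)=1$. $\mathbb Z_e^2=\{\mathbf i\in\mathbb Z^2:i_1+i_2\in2\mathbb Z\}$ and $\Lambda^\varphi=\{4/\varphi(\mathbf i):\mathbf i\in\mathbb Z_e^2\setminus\{(0,0)\}\}$. $\mathcal X$ is the space of subsets of $\mathbb R^2$ of finite perimeter, with the Hausdorff distance. For $\varepsilon>0$, $q_\varepsilon(\mathbf x)=\mathbf x+[-\varepsilon/2,\varepsilon/2]^2$, $q_\varepsilon=q_\varepsilon(0)$; $\mathcal D_\varepsilon$ is the class of sets $\bigcup_{\mathbf i\in\mathcal I}q_\varepsilon(\mathbf i)$ with $\mathcal I\subset\varepsilon\mathbb Z^2$, and $Z_\varepsilon(E)=E\cap\varepsilon\mathbb Z^2$ for $E\in\mathcal D_\varepsilon$. Energies are considered on sets of finite perimeter. For $\mathcal I\subset\varepsilon\mathbb Z^2$ and $\mathbf i\in\varepsilon\mathbb Z^2$ let $d_\varepsilon^\varphi(\mathbf i,\partial\mathcal I)=\inf\{\varphi(\mathbf i-\mathbf j):\mathbf j\in\mathcal I\}$ if $\mathbf i\notin\mathcal I$, and $=\inf\{\varphi(\mathbf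 i-\mathbf j):\mathbf j\in\varepsilon\mathbb Z^2\setminus\mathcal I\}$ if $\mathbf i\in\mathcal I$. For $E,F\in\mathcal D_\varepsilon$, $$\mathcal F_{\varepsilon,\tau}^\varphi(E,F)=-\varepsilon\,\mathcal H^1(\partial E)+\frac{\varepsilon^2}{\tau}\sum_{\mathbf i\in Z_\varepsilon(E)\triangle Z_\varepsilon(F)}d_\varepsilon^\varphi(\mathbf i,\partial Z_\varepsilon(F)).$$ **Scheme (S).** $E_{\varepsilon,\tau}^0=q_\varepsilon$, and for $k\ge0$, $E_{\varepsilon,\tau}^{k+1}$ is a minimizer of $\mathcal F_{\varepsilon,\tau}^\varphi(\cdot,E_{\varepsilon,\tau}^k)$ among $E\in\mathcal D_\varepsilon$ with $E\supset E_{\varepsilon,\tau}^k$; $E_{\varepsilon,\tau}(t)=E_{\varepsilon,\tau}^{\lfloor t/\tau\rfloor}$. For $\alpha>0$, a minimizing movement $E^\alpha:[0,+\infty)\to\mathcal X$ of (S) at regime $\varepsilon=\alpha\tau$ is a pointwise (in $t$) limit, in the Hausdorff distance, of such $E_{\varepsilon,\tau}$ with $\varepsilon=\alpha\tau$ as $\varepsilon,\tau\to0$, up to subsequences. **Pinning threshold.** $$\alpha_\varphi:=\inf\{\alpha>0:\ E^\alpha(t)\equiv\{(0,0)\}\text{ for every minimizing movement }E^\alpha\text{ of (S) at regime }\varepsilon=\alpha\tau\}.$$ *)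

theory Defs
  imports "HOL-Analysis.Analysis"
begin

section \<open>Norms on the plane\<close>

definition is_norm :: "(real \<times> real \<Rightarrow> real) \<Rightarrow> bool" where
  "is_norm \<phi> \<longleftrightarrow>
     (\<forall>x. 0 \<le> \<phi> x) \<and> (\<forall>x. \<phi> x = 0 \<longleftrightarrow> x = 0) \<and>
     (\<forall>c x. \<phi> (c *\<^sub>R x) = \<bar>c\<bar> * \<phi> x) \<and> (\<forall>x y. \<phi> (x + y) \<le> \<phi> x + \<phi> y)"

definition absolute :: "(real \<times> real \<Rightarrow> real) \<Rightarrow> bool" where
  "absolute \<phi> \<longleftrightarrow>
     (\<forall>x y. \<bar>fst x\<bar> = \<bar>fst y\<bar> \<and> \<bar>snd x\<bar> = \<bar>snd y\<bar> \<longrightarrow> \<phi> x = \<phi> y)"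

definition symmetric :: "(real \<times> real \<Rightarrow> real) \<Rightarrow> bool" where
  "symmetric \<phi> \<longleftrightarrow> (\<forall>a b. \<phi> (a, b) = \<phi> (b, a))"

definition normalized :: "(real \<times> real \<Rightarrow> real) \<Rightarrow> bool" where
  "normalized \<phi> \<longleftrightarrow> \<phi> (1, 0) = 1 \<and> \<phi> (0, 1) = 1"

definition Lambda :: "(real \<times> real \<Rightarrow> real) \<Rightarrow> real set" where
  "Lambda \<phi> = {4 / \<phi> (of_int i, of_int j) | i j. even (i + j) \<and> (i, j) \<noteq> (0, 0)}"


section \<open>Hausdorff distance, one-dimensional Hausdorff measure, perimeter\<close>

text \<open>Extended-valued, so that no boundedness or nonemptiness is presupposed; on arbitrary sets
  this is a pseudometric that identifies a set with its closure.\<close>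

definition hausdorff_dist :: "'a::metric_space set \<Rightarrow> 'a set \<Rightarrow> ennreal" where
  "hausdorff_dist A B =
     max (SUP x\<in>A. INF y\<in>B. ennreal (dist x y)) (SUP y\<in>B. INF x\<in>A. ennreal (dist x y))"

text \<open>Boundedness is required because \<^term>\<open>diameter\<close> is only meaningful for bounded sets.\<close>

definition hausdorff1 :: "'a::metric_space set \<Rightarrow> ennreal" where
  "hausdorff1 A =
     (SUP \<delta>\<in>{0<..}. INF U\<in>{U :: nat \<Rightarrow> 'a set. A \<subseteq> (\<Union>n. U n) \<and>
                                 (\<forall>n. bounded (U n) \<and> diameter (U n) \<le> \<delta>)}.
        (\<Sum>n. ennreal (diameter (U n))))"

definition divergence :: "('a::euclidean_space \<Rightarrow> 'a) \<Rightarrow> 'a \<Rightarrow> real" where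
  "divergence T x = (\<Sum>b\<in>Basis. frechet_derivative T (at x) b \<bullet> b)"

definition C1_compact_support :: "('a::euclidean_space \<Rightarrow> 'a) \<Rightarrow> bool" where
  "C1_compact_support T \<longleftrightarrow>
     (\<forall>x. T differentiable (at x)) \<and>
     (\<forall>b\<in>Basis. continuous_on UNIV (\<lambda>x. frechet_derivative T (at x) b)) \<and>
     compact (closure {x. T x \<noteq> 0})"

definition perimeter :: "'a::euclidean_space set \<Rightarrow> ereal" where
  "perimeter E =
     (SUP T\<in>{T. C1_compact_support T \<and> (\<forall>x. norm (T x) \<le> 1)}.
        ereal (LINT x:E|lebesgue. divergence T x))"

definition finite_perimeter :: "'a::euclidean_space set \<Rightarrow> bool" where
  "finite_perimeter E \<longleftrightarrow> E \<in> sets lebesgue \<and> perimeter E < \<infinity>"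


section \<open>Discrete sets and the energy\<close>

definition lattice :: "real \<Rightarrow> (real \<times> real) set" where
  "lattice \<epsilon> = {(\<epsilon> * of_int i, \<epsilon> * of_int j) | i j. True}"

definition cell :: "real \<Rightarrow> real \<times> real \<Rightarrow> (real \<times> real) set" where
  "cell \<epsilon> x = (+) x ` ({-\<epsilon>/2..\<epsilon>/2} \<times> {-\<epsilon>/2..\<epsilon>/2})"

definition discrete_sets :: "real \<Rightarrow> (real \<times> real) set set" where
  "discrete_sets \<epsilon> = {(\<Union>i\<in>I. cell \<epsilon> i) | I. I \<subseteq> lattice \<epsilon>}"

definition centers :: "real \<Rightarrow> (real \<times> real) set \<Rightarrow> (real \<times> real) set" where
  "centers \<epsilon> E = E \<inter> lattice \<epsilon>"

text \<open>Valued in \<^typ>\<open>ennreal\<close>, where the infimum over the empty set is infinite.\<close>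

definition discrete_dist ::
  "(real \<times> real \<Rightarrow> real) \<Rightarrow> real \<Rightarrow> real \<times> real \<Rightarrow> (real \<times> real) set \<Rightarrow> ennreal" where
  "discrete_dist \<phi> \<epsilon> i I =
     (if i \<in> I then INF j\<in>lattice \<epsilon> - I. ennreal (\<phi> (i - j))
      else INF j\<in>I. ennreal (\<phi> (i - j)))"

text \<open>For discrete sets of finite perimeter the first summand is finite, so the extended sum is
  unambiguous.\<close>

definition energy ::
  "(real \<times> real \<Rightarrow> real) \<Rightarrow> real \<Rightarrow> real \<Rightarrow> (real \<times> real) set \<Rightarrow> (real \<times> real) set \<Rightarrow> ereal" where
  "energy \<phi> \<epsilon> \<tau> E F =
     - (ereal \<epsilon> * enn2ereal (hausdorff1 (frontier E))) +
     ereal (\<epsilon>\<^sup>2 / \<tau>) *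
       enn2ereal (\<Sum>\<^sub>\<infinity>i\<in>sym_diff (centers \<epsilon> E) (centers \<epsilon> F). discrete_dist \<phi> \<epsilon> i (centers \<epsilon> F))"


section \<open>The scheme and its minimizing movements\<close>

definition discrete_solution ::
  "(real \<times> real \<Rightarrow> real) \<Rightarrow> real \<Rightarrow> real \<Rightarrow> (nat \<Rightarrow> (real \<times> real) set) \<Rightarrow> bool" where
  "discrete_solution \<phi> \<epsilon> \<tau> E \<longleftrightarrow>
     E 0 = cell \<epsilon> (0, 0) \<and>
     (\<forall>k. is_arg_min (\<lambda>A. energy \<phi> \<epsilon> \<tau> A (E k))
            (\<lambda>A. A \<in> discrete_sets \<epsilon> \<and> finite_perimeter A \<and> E k \<subseteq> A) (E (Suc k)))"

text \<open>The sequence \<open>\<tau>\<close> plays the role of the extracted subsequence, which does not depend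
  on \<open>t\<close>. Only the values of \<open>X\<close> at nonnegative times are relevant.\<close>

definition minimizing_movement ::
  "(real \<times> real \<Rightarrow> real) \<Rightarrow> real \<Rightarrow> (real \<Rightarrow> (real \<times> real) set) \<Rightarrow> bool" where
  "minimizing_movement \<phi> \<alpha> X \<longleftrightarrow>
     (\<forall>t\<ge>0. finite_perimeter (X t)) \<and>
     (\<exists>(\<tau> :: nat \<Rightarrow> real) E.
        (\<forall>n. \<tau> n > 0) \<and> \<tau> \<longlonglongrightarrow> 0 \<and>
        (\<forall>n. discrete_solution \<phi> (\<alpha> * \<tau> n) (\<tau> n) (E n)) \<and>
        (\<forall>t\<ge>0. (\<lambda>n. hausdorff_dist (E n (nat \<lfloor>t / \<tau> n\<rfloor>)) (X t)) \<longlonglongrightarrow> 0))"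

definition pinning_threshold :: "(real \<times> real \<Rightarrow> real) \<Rightarrow> real" where
  "pinning_threshold \<phi> =
     Inf {\<alpha>. \<alpha> > 0 \<and> (\<forall>X. minimizing_movement \<phi> \<alpha> X \<longrightarrow> (\<forall>t\<ge>0. X t = {(0, 0)}))}"

end

theory Submission
  imports Defs "HOL-Complex_Analysis.Great_Picard"
begin

text \<open>Since the frontier of a finite union of cells has length \<open>\<epsilon>\<close> times the number of its boundary
  edges, at \<open>\<epsilon> = \<alpha> \<tau>\<close> the energy of a step from \<open>J\<close> to \<open>I\<close> on the unit lattice is
  \<open>\<epsilon>\<^sup>2 (\<alpha> \<Sum>\<^bsub>i \<in> I - J\<^esub> d(i, J) - number of boundary edges of I)\<close>, so the scheme depends only on \<open>\<alpha>\<close>.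

  If \<open>\<alpha> > 4 / \<phi>(1, 1)\<close>, which is at least 2, a first step gains at most two edges from each neighbour
  of the origin, at cost \<open>\<alpha> > 2\<close>, and at most four from every other cell, at cost at least
  \<open>\<alpha> \<phi>(1, 1) > 4\<close>; hence the nucleus is the unique minimizer and nothing moves.
  If \<open>\<alpha> < 4 / \<phi>(1, 1)\<close>, adding the diagonal neighbour of a point extremal in direction \<open>(1, 1)\<close> gains four
  edges at cost less than four, so the maximum of \<open>i\<^sub>1 + i\<^sub>2\<close> increases at each step. Cells farther than
  \<open>4 / \<alpha>\<close> are never added, so the speed is bounded, and compactness of the distance functions yields
  a limit movement, which contains a point with \<open>x\<^sub>1 + x\<^sub>2 \<ge> \<alpha> t\<close> at time \<open>t\<close>.\<close>


section \<open>One-dimensional Hausdorff measure\<close>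

text \<open>Pinning quantifies over all movements and would hold vacuously at any \<alpha> that
  admits none. Below the threshold a movement therefore has to be exhibited, with one subsequence
  serving all times. The strict ranges on both sides already determine the infimum, so the behaviour
  at \<alpha> = 4 / \<phi>(1, 1) itself is never examined. The count of boundary edges must be
  extracted from a length defined by coverings. Full edges can share endpoints, so the lower bound
  shortens them to disjoint compact sets, on which the measure is superadditive, and lets the loss
  tend to zero. Competitors may be infinite unions of cells. Finite unions have finite perimeter and
  so are admissible, while an infinite addition has infinite dissipation; this reduces the scheme to
  finite index sets. The diagonal decides because \<phi>(1, 1) \<le> 2 by the triangle inequality:
  two edges for a neighbour at distance 1 are no better a bargain than four edges at distance
  \<phi>(1, 1). The maximum over \<open>Lambda\<close> rests on the same comparison of lattice
  vectors.\<close>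

lemma hausdorff1_mono: "A \<subseteq> B \<Longrightarrow> hausdorff1 A \<le> hausdorff1 B"
  unfolding hausdorff1_def by (intro SUP_mono' INF_superset_mono) blast+

text \<open>The definition asks for sequences of covering sets; a finite cover is padded with empty
  sets, whose diameter is 0. The index type stays free so that pieces of edges can serve as
  indices.\<close>

lemma hausdorff1_le:
  fixes A :: "'a::metric_space set"
  assumes "\<And>\<delta>. \<delta> > 0 \<Longrightarrow> \<exists>(T :: 'i set) U. finite T \<and> A \<subseteq> (\<Union>t\<in>T. U t) \<and>
             (\<forall>t\<in>T. bounded (U t) \<and> diameter (U t) \<le> \<delta>) \<and> (\<Sum>t\<in>T. diameter (U t)) \<le> L"
  shows "hausdorff1 A \<le> ennreal L"
  unfolding hausdorff1_def
proof (rule SUP_least)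
  fix \<delta> :: real assume "\<delta> \<in> {0<..}"
  then have \<delta>: "\<delta> > 0" by simp
  obtain T :: "'i set" and U where T: "finite T" "A \<subseteq> (\<Union>t\<in>T. U t)"
    "\<And>t. t \<in> T \<Longrightarrow> bounded (U t) \<and> diameter (U t) \<le> \<delta>" "(\<Sum>t\<in>T. diameter (U t)) \<le> L"
    using assms[OF \<delta>] by blast
  obtain h where h: "bij_betw h {..<card T} T"
    using \<open>finite T\<close> bij_betw_from_nat_into_finite by blast
  define V where "V n = (if n < card T then U (h n) else {})" for n
  have hT: "h n \<in> T" if "n < card T" for n using h that by (auto simp: bij_betw_def)
  have "A \<subseteq> (\<Union>n. V n)"
  proof
    fix x assume "x \<in> A"
    then obtain t where "t \<in> T" "x \<in> U t" using T by auto
    moreover then obtain n where "n < card T" "t = h n"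
      using h unfolding bij_betw_def by (metis imageE lessThan_iff)
    ultimately show "x \<in> (\<Union>n. V n)" by (auto simp: V_def intro!: exI[of _ n])
  qed
  then have V: "V \<in> {U :: nat \<Rightarrow> 'a set. A \<subseteq> (\<Union>n. U n) \<and> (\<forall>n. bounded (U n) \<and> diameter (U n) \<le> \<delta>)}"
    using T(3) hT \<delta> by (auto simp: V_def)
  have "(\<Sum>n. ennreal (diameter (V n))) = (\<Sum>n<card T. ennreal (diameter (V n)))"
    by (rule suminf_finite) (auto simp: V_def)
  also have "\<dots> = (\<Sum>n<card T. ennreal (diameter (U (h n))))" by (simp add: V_def)
  also have "\<dots> = (\<Sum>t\<in>T. ennreal (diameter (U t)))" by (rule sum.reindex_bij_betw[OF h])
  also have "\<dots> = ennreal (\<Sum>t\<in>T. diameter (U t))"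
    by (rule sum_ennreal) (use T diameter_ge_0 in auto)
  also have "\<dots> \<le> ennreal L" using T(4) by (rule ennreal_leI)
  finally show "(INF U\<in>{U :: nat \<Rightarrow> 'a set. A \<subseteq> (\<Union>n. U n) \<and> (\<forall>n. bounded (U n) \<and> diameter (U n) \<le> \<delta>)}.
        (\<Sum>n. ennreal (diameter (U n)))) \<le> ennreal L"
    using V by (rule INF_lower2[rotated])
qed

text \<open>The measure is a supremum over scales, so one scale is enough for a lower bound.\<close>

lemma hausdorff1_ge:
  assumes "\<delta> > 0"
    and "\<And>U. A \<subseteq> (\<Union>n. U n) \<Longrightarrow> (\<And>n. bounded (U n)) \<Longrightarrow> (\<And>n. diameter (U n) \<le> \<delta>) \<Longrightarrow>
           c \<le> (\<Sum>n. ennreal (diameter (U n)))"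
  shows "c \<le> hausdorff1 A"
  unfolding hausdorff1_def using assms
  by (intro SUP_upper2[of \<delta>] INF_greatest) auto

text \<open>A 1-Lipschitz map does not increase diameters, so a cover of \<open>A\<close> yields
  intervals covering \<open>{a..b}\<close>, and Lebesgue measure is countably subadditive. The image
  of a covering set may fail to be measurable; the interval from its infimum to its supremum
  replaces it.\<close>

lemma hausdorff1_ge_interval:
  fixes g :: "'a::metric_space \<Rightarrow> real"
  assumes g: "\<And>x y. \<bar>g x - g y\<bar> \<le> dist x y" and ab: "{a..b} \<subseteq> g ` A"
  shows "ennreal (b - a) \<le> hausdorff1 A"
proof (rule hausdorff1_ge[of 1])
  fix U :: "nat \<Rightarrow> 'a set"
  assume U: "A \<subseteq> (\<Union>n. U n)" "\<And>n. bounded (U n)"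
  have "\<exists>l r. g ` U n \<subseteq> {l..r} \<and> r - l \<le> diameter (U n) \<and> l \<le> r" for n
  proof (cases "U n = {}")
    case False
    have le: "g x \<le> g y + diameter (U n)" if "x \<in> U n" "y \<in> U n" for x y
      using g[of x y] diameter_bounded_bound[OF U(2) that] by linarith
    obtain u where u: "u \<in> U n" using False by auto
    have ba: "bdd_above (g ` U n)" using le u by (intro bdd_aboveI2) auto
    have bb: "bdd_below (g ` U n)"
      using le[OF u] by (intro bdd_belowI2[of _ "g u - diameter (U n)"]) (simp add: diff_le_eq)
    have "(SUP x\<in>U n. g x) \<le> g y + diameter (U n)" if "y \<in> U n" for y
      using False le that by (intro cSUP_least) auto
    then have "(SUP x\<in>U n. g x) - diameter (U n) \<le> (INF y\<in>U n. g y)"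
      using False by (intro cINF_greatest) (auto simp: diff_le_eq)
    moreover have "g ` U n \<subseteq> {INF y\<in>U n. g y..SUP x\<in>U n. g x}"
      using ba bb by (auto intro!: cINF_lower cSUP_upper)
    ultimately show ?thesis using u
      by (intro exI[of _ "INF y\<in>U n. g y"] exI[of _ "SUP x\<in>U n. g x"]) force
  qed (auto intro!: exI[of _ 0])
  then obtain l r where lr: "\<And>n. g ` U n \<subseteq> {l n..r n}" "\<And>n. r n - l n \<le> diameter (U n)"
      "\<And>n. l n \<le> r n" by metis
  have "{a..b} \<subseteq> (\<Union>n. {l n..r n})" 
  proof
    fix x assume "x \<in> {a..b}"
    then obtain z where "z \<in> A" "x = g z" using ab by auto
    moreover then obtain n where "z \<in> U n" using U(1) by auto
    ultimately show "x \<in> (\<Union>n. {l n..r n})" using lr(1)[of n] by blast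
  qed
  then have "emeasure lborel {a..b} \<le> emeasure lborel (\<Union>n. {l n..r n})"
    by (intro emeasure_mono) auto
  also have "\<dots> \<le> (\<Sum>n. emeasure lborel {l n..r n})"
    by (rule emeasure_subadditive_countably) auto
  also have "\<dots> \<le> (\<Sum>n. ennreal (diameter (U n)))"
    using lr by (intro suminf_le) (auto intro: ennreal_leI)
  finally show "ennreal (b - a) \<le> (\<Sum>n. ennreal (diameter (U n)))"
    by (cases "a \<le> b") (auto simp: ennreal_neg)
qed simp

text \<open>Disjoint compact sets have a positive distance \<open>d\<close>, and a covering set of
  diameter less than \<open>d\<close> cannot meet both. Fine covers thus split into a cover of
  \<open>A\<close> and a cover of \<open>B\<close>.\<close>

lemma hausdorff1_Un_ge:
  fixes A B :: "'a::heine_borel set"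
  assumes "compact A" "compact B" "A \<inter> B = {}"
  shows "hausdorff1 A + hausdorff1 B \<le> hausdorff1 (A \<union> B)"
proof -
  obtain d where d: "d > 0" "\<And>x y. x \<in> A \<Longrightarrow> y \<in> B \<Longrightarrow> d \<le> dist x y"
    using separate_compact_closed[OF assms(1) compact_imp_closed[OF assms(2)] assms(3)] by blast
  let ?C = "\<lambda>A \<delta>. {U :: nat \<Rightarrow> 'a set. A \<subseteq> (\<Union>n. U n) \<and> (\<forall>n. bounded (U n) \<and> diameter (U n) \<le> \<delta>)}"
  define h where "h A \<delta> = (INF U\<in>?C A \<delta>. (\<Sum>n. ennreal (diameter (U n))))" for A \<delta>
  have H: "hausdorff1 A = (SUP \<delta>\<in>{0<..}. h A \<delta>)" for A by (simp add: hausdorff1_def h_def)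
  have anti: "h A \<delta> \<le> h A \<delta>'" if "\<delta>' \<le> \<delta>" for A \<delta> \<delta>'
    unfolding h_def using that by (intro INF_superset_mono) (auto intro: order_trans)
  have split: "h A \<delta> + h B \<delta> \<le> h (A \<union> B) \<delta>" if \<delta>: "\<delta> < d" for \<delta>
    unfolding h_def[of "A \<union> B"]
  proof (rule INF_greatest)
    fix U assume "U \<in> ?C (A \<union> B) \<delta>"
    then have U: "A \<union> B \<subseteq> (\<Union>n. U n)" "\<And>n. bounded (U n)" "\<And>n. diameter (U n) \<le> \<delta>" by auto
    have bI: "bounded (U n \<inter> S)" for n S using U(2) by (rule bounded_subset) auto
    have dI: "diameter (U n \<inter> S) \<le> diameter (U n)" for n S using U(2) by (intro diameter_subset) auto
    have sub: "h S \<delta> \<le> (\<Sum>n. ennreal (diameter (U n \<inter> S)))" if "S \<subseteq> A \<union> B" for S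
      unfolding h_def by (rule INF_lower) (use that U bI order_trans[OF dI U(3)] in auto)
    have "U n \<inter> A = {} \<or> U n \<inter> B = {}" for n
    proof (rule ccontr)
      assume "\<not> ?thesis"
      then obtain x y where "x \<in> U n" "x \<in> A" "y \<in> U n" "y \<in> B" by auto
      then show False
        using d(2)[of x y] diameter_bounded_bound[OF U(2), of x n y] U(3)[of n] \<delta> by linarith
    qed
    \<comment> \<open>One of the two intersections is empty and contributes 0.\<close>
    then have le: "ennreal (diameter (U n \<inter> A)) + ennreal (diameter (U n \<inter> B)) \<le> ennreal (diameter (U n))" for n
      using dI[of n] by (metis add.right_neutral add.left_neutral diameter_empty ennreal_0 ennreal_leI)
    have "h A \<delta> + h B \<delta> \<le> (\<Sum>n. ennreal (diameter (U n \<inter> A))) + (\<Sum>n. ennreal (diameter (U n \<inter> B)))"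
      by (intro add_mono sub) auto
    also have "\<dots> = (\<Sum>n. ennreal (diameter (U n \<inter> A)) + ennreal (diameter (U n \<inter> B)))"
      by (rule suminf_add) auto
    also have "\<dots> \<le> (\<Sum>n. ennreal (diameter (U n)))"
      by (intro suminf_le le) auto
    finally show "h A \<delta> + h B \<delta> \<le> (\<Sum>n. ennreal (diameter (U n)))" .
  qed
  have "h A \<delta> + h B \<delta>' \<le> hausdorff1 (A \<union> B)" if "\<delta> > 0" "\<delta>' > 0" for \<delta> \<delta>'
  proof -
    \<comment> \<open>The suprema for \<open>A\<close> and \<open>B\<close> run over independent
      scales; both are refined to a common one below \<open>d\<close>.\<close>
    define \<rho> where "\<rho> = min (min \<delta> \<delta>') (d / 2)"
    have \<rho>: "\<rho> > 0" "\<rho> < d" "\<rho> \<le> \<delta>" "\<rho> \<le> \<delta>'" using that d by (auto simp: \<rho>_def)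
    have "h A \<delta> + h B \<delta>' \<le> h A \<rho> + h B \<rho>" using \<rho> by (intro add_mono anti)
    also have "\<dots> \<le> h (A \<union> B) \<rho>" by (rule split) fact
    also have "\<dots> \<le> hausdorff1 (A \<union> B)" unfolding H using \<rho> by (intro SUP_upper) auto
    finally show ?thesis .
  qed
  then have "(SUP \<delta>\<in>{0<..}. h A \<delta> + h B \<delta>') \<le> hausdorff1 (A \<union> B)" if "\<delta>' > 0" for \<delta>'
    using that by (intro SUP_least) auto
  moreover have "(SUP \<delta>\<in>{0<..}. h A \<delta> + h B \<delta>') = hausdorff1 A + h B \<delta>'" for \<delta>'
    unfolding H by (rule ennreal_SUP_add_left) auto
  ultimately have "(SUP \<delta>'\<in>{0<..}. hausdorff1 A + h B \<delta>') \<le> hausdorff1 (A \<union> B)"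
    by (intro SUP_least) auto
  moreover have "(SUP \<delta>'\<in>{0<..}. hausdorff1 A + h B \<delta>') = hausdorff1 A + hausdorff1 B"
    unfolding H[of B] by (rule ennreal_SUP_add_right[symmetric]) auto
  ultimately show ?thesis by simp
qed

lemma hausdorff1_UN_ge:
  fixes A :: "'i \<Rightarrow> 'a::heine_borel set"
  assumes "finite S" "\<And>s. s \<in> S \<Longrightarrow> compact (A s)"
    and "\<And>s t. s \<in> S \<Longrightarrow> t \<in> S \<Longrightarrow> s \<noteq> t \<Longrightarrow> A s \<inter> A t = {}"
  shows "(\<Sum>s\<in>S. hausdorff1 (A s)) \<le> hausdorff1 (\<Union>s\<in>S. A s)"
  using assms
proof (induction S rule: finite_induct)
  case (insert s S)
  have "(\<Sum>s\<in>insert s S. hausdorff1 (A s)) \<le> hausdorff1 (A s) + hausdorff1 (\<Union>s\<in>S. A s)"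
    using insert by (auto intro!: add_mono)
  also have "\<dots> \<le> hausdorff1 (A s \<union> (\<Union>s\<in>S. A s))"
  proof (intro hausdorff1_Un_ge compact_UN)
    have "A s \<inter> A t = {}" if "t \<in> S" for t using insert.prems(2)[of s t] insert.hyps(2) that by auto
    then show "A s \<inter> (\<Union>s\<in>S. A s) = {}" by blast
  qed (use insert in auto)
  finally show ?case by simp
qed simp

section \<open>Boundaries of unions of cells\<close>

text \<open>Sites are indexed by integer pairs so that the mesh size enters only as a factor;
  \<open>pt 1\<close> is the inclusion of the integer pairs into the plane.\<close>

definition pt :: "real \<Rightarrow> int \<times> int \<Rightarrow> real \<times> real" where
  "pt \<epsilon> i = (\<epsilon> * of_int (fst i), \<epsilon> * of_int (snd i))"

definition cells :: "real \<Rightarrow> (int \<times> int) set \<Rightarrow> (real \<times> real) set" where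
  "cells \<epsilon> I = (\<Union>i\<in>I. cell \<epsilon> (pt \<epsilon> i))"

definition dirs :: "(int \<times> int) set" where
  "dirs = {(1, 0), (-1, 0), (0, 1), (0, -1)}"

text \<open>A boundary edge has a cell of \<open>I\<close> on exactly one side. Orienting it from
  that side lists every edge once.\<close>

definition boundary_pairs :: "(int \<times> int) set \<Rightarrow> ((int \<times> int) \<times> (int \<times> int)) set" where
  "boundary_pairs I = {(i, e). i \<in> I \<and> e \<in> dirs \<and> i + e \<notin> I}"

text \<open>The edge \<open>(i, e)\<close> is the side of the cell at \<open>i\<close> facing the cell at \<open>i + e\<close>, cut down to half-length
  \<open>r\<close> around its midpoint; \<open>r = \<epsilon> / 2\<close> is the whole side, and for \<open>r < \<epsilon> / 2\<close> distinct edges are disjoint.\<close>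

definition edge :: "real \<Rightarrow> real \<Rightarrow> (int \<times> int) \<times> (int \<times> int) \<Rightarrow> (real \<times> real) set" where
  "edge \<epsilon> r = (\<lambda>(i, e). {x. \<bar>fst x - \<epsilon> * (of_int (fst i) + of_int (fst e) / 2)\<bar> \<le> r * of_int \<bar>snd e\<bar> \<and>
                       \<bar>snd x - \<epsilon> * (of_int (snd i) + of_int (snd e) / 2)\<bar> \<le> r * of_int \<bar>fst e\<bar>})"

lemma finite_dirs [simp]: "finite dirs" and card_dirs: "card dirs = 4"
  by (auto simp: dirs_def)

lemma mem_cell:
  "x \<in> cell \<epsilon> (pt \<epsilon> i) \<longleftrightarrow>
     \<bar>fst x - \<epsilon> * of_int (fst i)\<bar> \<le> \<epsilon> / 2 \<and> \<bar>snd x - \<epsilon> * of_int (snd i)\<bar> \<le> \<epsilon> / 2"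
proof -
  have "x \<in> cell \<epsilon> (pt \<epsilon> i) \<longleftrightarrow> x - pt \<epsilon> i \<in> {-\<epsilon>/2..\<epsilon>/2} \<times> {-\<epsilon>/2..\<epsilon>/2}"
  proof
    assume "x - pt \<epsilon> i \<in> {-\<epsilon>/2..\<epsilon>/2} \<times> {-\<epsilon>/2..\<epsilon>/2}"
    then have "pt \<epsilon> i + (x - pt \<epsilon> i) \<in> cell \<epsilon> (pt \<epsilon> i)" unfolding cell_def by (rule imageI)
    then show "x \<in> cell \<epsilon> (pt \<epsilon> i)" by simp
  qed (auto simp: cell_def)
  then show ?thesis
    unfolding mem_Times_iff atLeastAtMost_iff pt_def fst_diff snd_diff fst_conv snd_conv by linarith
qed

lemma abs_diff_mult_left: "\<epsilon> > 0 \<Longrightarrow> \<bar>\<epsilon> * a - \<epsilon> * b\<bar> = \<epsilon> * \<bar>a - b\<bar>" for \<epsilon> :: real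
  by (simp add: abs_mult right_diff_distrib[symmetric])

lemma close_multiples_eq:
  fixes \<epsilon> :: real
  assumes "\<epsilon> > 0" "\<bar>\<epsilon> * of_int k - \<epsilon> * of_int l\<bar> < \<epsilon>"
  shows "k = l"
proof -
  have "\<epsilon> * \<bar>of_int (k - l)\<bar> < \<epsilon> * 1"
    using assms by (simp add: abs_diff_mult_left)
  then have "\<bar>of_int (k - l) :: real\<bar> < 1" using assms(1) by simp
  then have "\<bar>k - l\<bar> < 1" by linarith
  then show ?thesis by simp
qed

lemma open_cell_unique:
  assumes "\<epsilon> > 0" "\<bar>fst x - \<epsilon> * of_int (fst i)\<bar> < \<epsilon> / 2" "\<bar>snd x - \<epsilon> * of_int (snd i)\<bar> < \<epsilon> / 2"
    and "x \<in> cell \<epsilon> (pt \<epsilon> j)"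
  shows "j = i"
  using assms unfolding mem_cell
  by (intro prod_eqI close_multiples_eq[OF assms(1)]) linarith+

lemma edge_subset_cells:
  assumes "\<epsilon> > 0" "e \<in> dirs" "x \<in> edge \<epsilon> (\<epsilon> / 2) (i, e)"
  shows "x \<in> cell \<epsilon> (pt \<epsilon> i)" "x \<in> cell \<epsilon> (pt \<epsilon> (i + e))"
  using assms unfolding mem_cell edge_def dirs_def by (auto simp: algebra_simps abs_le_iff)

lemma edge_mono: "r \<le> s \<Longrightarrow> edge \<epsilon> r p \<subseteq> edge \<epsilon> s p"
  unfolding edge_def by (auto split: prod.splits intro: order_trans[OF _ mult_right_mono])

lemma edge_eq_Times:
  "edge \<epsilon> r (i, e) =
     {\<epsilon> * (of_int (fst i) + of_int (fst e) / 2) - r * of_int \<bar>snd e\<bar>..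
      \<epsilon> * (of_int (fst i) + of_int (fst e) / 2) + r * of_int \<bar>snd e\<bar>} \<times>
     {\<epsilon> * (of_int (snd i) + of_int (snd e) / 2) - r * of_int \<bar>fst e\<bar>..
      \<epsilon> * (of_int (snd i) + of_int (snd e) / 2) + r * of_int \<bar>fst e\<bar>}"
  unfolding edge_def by (auto simp: abs_le_iff)

lemma compact_edge: "compact (edge \<epsilon> r p)"
  by (cases p) (simp add: edge_eq_Times compact_Times)

text \<open>The endpoints of a side are corners where four cells meet. Staying away from them, by
  \<open>r < \<epsilon> / 2\<close>, leaves only the two cells that share the side.\<close>

lemma edge_cell_cases:
  assumes \<epsilon>: "\<epsilon> > 0" and r: "r < \<epsilon> / 2" and e: "e \<in> dirs"
    and x: "x \<in> edge \<epsilon> r (i, e)" and j: "x \<in> cell \<epsilon> (pt \<epsilon> j)"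
  shows "j = i \<or> j = i + e"
proof -
  \<comment> \<open>Across the edge, a point halfway between two neighbouring centres admits only
    these two indices. Along the edge, \<open>eq\<close> below leaves a single index.\<close>
  have k: "k = l \<or> k = l + 1"
    if "\<bar>\<epsilon> * (of_int l + 1 / 2) - \<epsilon> * of_int k\<bar> \<le> \<epsilon> / 2" for k l :: int
  proof -
    have "\<epsilon> * \<bar>(of_int l + 1 / 2) - of_int k\<bar> \<le> \<epsilon> * (1 / 2)"
      using that \<epsilon> by (simp add: abs_diff_mult_left)
    then have "\<bar>(of_int l + 1 / 2) - of_int k :: real\<bar> \<le> 1 / 2"
      using \<epsilon> by (subst (asm) mult_le_cancel_left_pos) auto
    then show ?thesis by linarith
  qed
  obtain i1 i2 j1 j2 x1 x2 where [simp]: "i = (i1, i2)" "j = (j1, j2)" "x = (x1, x2)"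
    by (metis surj_pair)
  have j': "\<bar>x1 - \<epsilon> * of_int j1\<bar> \<le> \<epsilon> / 2" "\<bar>x2 - \<epsilon> * of_int j2\<bar> \<le> \<epsilon> / 2"
    using j by (auto simp: mem_cell)
  have eq: "j' = i'" if "\<bar>z - \<epsilon> * of_int i'\<bar> \<le> r" "\<bar>z - \<epsilon> * of_int j'\<bar> \<le> \<epsilon> / 2" for z i' j'
    by (rule close_multiples_eq[OF \<epsilon>]) (use that r in linarith)
  from e consider "e = (1, 0)" | "e = (-1, 0)" | "e = (0, 1)" | "e = (0, -1)"
    by (auto simp: dirs_def)
  then show ?thesis
  proof cases
    case 1
    then show ?thesis using x j' eq[of x2 i2 j2] k[of i1 j1] by (auto simp: edge_def)
  next
    case 2
    \<comment> \<open>The left side of a cell is the right side of its left neighbour, so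
      \<open>k\<close> applies with index \<open>i1 - 1\<close>.\<close>
    then have "x1 = \<epsilon> * (of_int (i1 - 1) + 1 / 2)" using x by (simp add: edge_def algebra_simps)
    then show ?thesis using 2 x j' eq[of x2 i2 j2] k[of "i1 - 1" j1] by (auto simp: edge_def)
  next
    case 3
    then show ?thesis using x j' eq[of x1 i1 j1] k[of i2 j2] by (auto simp: edge_def)
  next
    case 4
    then have "x2 = \<epsilon> * (of_int (i2 - 1) + 1 / 2)" using x by (simp add: edge_def algebra_simps)
    then show ?thesis using 4 x j' eq[of x1 i1 j1] k[of "i2 - 1" j2] by (auto simp: edge_def)
  qed
qed

text \<open>A common point lies in the cells \<open>j\<close> and \<open>j + f\<close>, hence both
  are among \<open>i\<close> and \<open>i + e\<close>. Membership in \<open>I\<close> then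
  identifies the inner cells with each other, and likewise the outer ones.\<close>

lemma edge_disjoint:
  assumes "\<epsilon> > 0" "r < \<epsilon> / 2" "p \<in> boundary_pairs I" "q \<in> boundary_pairs I" "p \<noteq> q"
  shows "edge \<epsilon> r p \<inter> edge \<epsilon> r q = {}"
proof (rule ccontr)
  assume "\<not> ?thesis"
  then obtain x where x: "x \<in> edge \<epsilon> r p" "x \<in> edge \<epsilon> r q" by auto
  obtain i e j f where [simp]: "p = (i, e)" "q = (j, f)" by (metis surj_pair)
  have p: "i \<in> I" "e \<in> dirs" "i + e \<notin> I" and q: "j \<in> I" "f \<in> dirs" "j + f \<notin> I"
    using assms(3,4) by (auto simp: boundary_pairs_def)
  have "x \<in> edge \<epsilon> (\<epsilon> / 2) (j, f)" using x(2) edge_mono[of r "\<epsilon> / 2" \<epsilon> q] assms(2) by auto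
  then have "x \<in> cell \<epsilon> (pt \<epsilon> j)" "x \<in> cell \<epsilon> (pt \<epsilon> (j + f))" using edge_subset_cells assms(1) q by auto
  then have "j = i \<or> j = i + e" "j + f = i \<or> j + f = i + e"
    using edge_cell_cases[OF assms(1,2) p(2)] x(1) by auto
  then show False using p q \<open>p \<noteq> q\<close> by auto
qed

lemma cell_eq_Times:
  "cell \<epsilon> (pt \<epsilon> i) =
     {\<epsilon> * of_int (fst i) - \<epsilon> / 2..\<epsilon> * of_int (fst i) + \<epsilon> / 2} \<times>
     {\<epsilon> * of_int (snd i) - \<epsilon> / 2..\<epsilon> * of_int (snd i) + \<epsilon> / 2}"
  by (rule set_eqI) (simp only: mem_cell mem_Times_iff atLeastAtMost_iff, linarith)

lemma compact_cell: "compact (cell \<epsilon> (pt \<epsilon> i))"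
  by (simp add: cell_eq_Times compact_Times)

lemma compact_cells: "finite I \<Longrightarrow> compact (cells \<epsilon> I)"
  unfolding cells_def by (intro compact_UN compact_cell)

lemma ex_cell:
  assumes "\<epsilon> > 0" shows "\<exists>i. x \<in> cell \<epsilon> (pt \<epsilon> i)"
proof -
  have "\<exists>k::int. \<bar>z - \<epsilon> * of_int k\<bar> \<le> \<epsilon> / 2" for z
  proof -
    have "\<bar>z / \<epsilon> - of_int (round (z / \<epsilon>))\<bar> \<le> 1 / 2"
      using of_int_round_abs_le[of "z / \<epsilon>"] by linarith
    then have "\<epsilon> * \<bar>z / \<epsilon> - of_int (round (z / \<epsilon>))\<bar> \<le> \<epsilon> * (1 / 2)"
      using assms by (intro mult_left_mono) auto
    then have "\<bar>\<epsilon> * (z / \<epsilon> - of_int (round (z / \<epsilon>)))\<bar> \<le> \<epsilon> / 2"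
      using assms by (simp add: abs_mult)
    then show ?thesis using assms by (intro exI[of _ "round (z / \<epsilon>)"]) (simp add: right_diff_distrib)
  qed
  then obtain k l :: int where "\<bar>fst x - \<epsilon> * of_int k\<bar> \<le> \<epsilon> / 2" "\<bar>snd x - \<epsilon> * of_int l\<bar> \<le> \<epsilon> / 2" by blast
  then show ?thesis by (intro exI[of _ "(k, l)"]) (simp add: mem_cell)
qed

lemma finite_near_multiples:
  fixes z \<epsilon> b :: real
  assumes "\<epsilon> > 0" shows "finite {k::int. \<bar>z - \<epsilon> * of_int k\<bar> \<le> b}"
proof (rule finite_subset)
  show "{k. \<bar>z - \<epsilon> * of_int k\<bar> \<le> b} \<subseteq> {\<lfloor>(z - b) / \<epsilon>\<rfloor>..\<lceil>(z + b) / \<epsilon>\<rceil>}"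
  proof clarsimp
    fix k :: int assume "\<bar>z - \<epsilon> * of_int k\<bar> \<le> b"
    then have "(z - b) / \<epsilon> \<le> of_int k" "of_int k \<le> (z + b) / \<epsilon>"
      using assms by (auto simp: field_simps)
    then show "\<lfloor>(z - b) / \<epsilon>\<rfloor> \<le> k \<and> k \<le> \<lceil>(z + b) / \<epsilon>\<rceil>"
      by (meson dual_order.trans floor_le_iff le_ceiling_iff less_add_one linorder_not_le of_int_le_iff order_le_less_trans floor_mono floor_of_int of_int_floor_le le_of_int_ceiling)
  qed
qed simp

text \<open>A frontier point lies in a cell of \<open>I\<close> and, by local finiteness of the
  grid, also in a cell outside \<open>I\<close>. These two may touch only in a corner, so a third
  cell is placed between them.\<close>

lemma frontier_cells_subset:
  assumes \<epsilon>: "\<epsilon> > 0" and I: "finite I"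
  shows "frontier (cells \<epsilon> I) \<subseteq> (\<Union>p\<in>boundary_pairs I. edge \<epsilon> (\<epsilon> / 2) p)"
proof
  fix x assume x: "x \<in> frontier (cells \<epsilon> I)"
  have "closed (cells \<epsilon> I)" using compact_cells[OF I] by (rule compact_imp_closed)
  then have "x \<in> cells \<epsilon> I" using x frontier_subset_closed by blast
  then obtain i where i: "i \<in> I" "x \<in> cell \<epsilon> (pt \<epsilon> i)" by (auto simp: cells_def)
  define M where "M = {j. j \<notin> I \<and> \<bar>fst x - \<epsilon> * of_int (fst j)\<bar> \<le> 1 + \<epsilon> / 2 \<and> \<bar>snd x - \<epsilon> * of_int (snd j)\<bar> \<le> 1 + \<epsilon> / 2}"
  have "M \<subseteq> {k. \<bar>fst x - \<epsilon> * of_int k\<bar> \<le> 1 + \<epsilon> / 2} \<times> {k. \<bar>snd x - \<epsilon> * of_int k\<bar> \<le> 1 + \<epsilon> / 2}"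
    unfolding M_def by auto
  then have "finite M" by (rule finite_subset) (intro finite_cartesian_product finite_near_multiples \<epsilon>)
  then have cM: "closed (cells \<epsilon> M)" by (intro compact_imp_closed compact_cells)
  have "ball x 1 \<inter> - cells \<epsilon> I \<subseteq> cells \<epsilon> M"
  proof
    fix y assume y: "y \<in> ball x 1 \<inter> - cells \<epsilon> I"
    obtain j where j: "y \<in> cell \<epsilon> (pt \<epsilon> j)" using ex_cell[OF \<epsilon>] by blast
    then have "j \<notin> I" using y by (auto simp: cells_def)
    moreover have "dist (fst x) (fst y) < 1" "dist (snd x) (snd y) < 1"
      using y dist_fst_le[of x y] dist_snd_le[of x y] by auto
    ultimately have "j \<in> M" using j unfolding M_def mem_cell dist_real_def
      by (intro CollectI conjI; linarith)
    then show "y \<in> cells \<epsilon> M" using j by (auto simp: cells_def)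
  qed
  then have "closure (ball x 1 \<inter> - cells \<epsilon> I) \<subseteq> cells \<epsilon> M" using cM by (rule closure_minimal)
  moreover have "x \<in> closure (- cells \<epsilon> I)" using x by (simp add: frontier_closures)
  then have "x \<in> closure (ball x 1 \<inter> - cells \<epsilon> I)"
    using open_Int_closure_subset[of "ball x 1" "- cells \<epsilon> I"] by auto
  ultimately obtain j where j: "j \<notin> I" "x \<in> cell \<epsilon> (pt \<epsilon> j)" by (auto simp: cells_def M_def)
  have near: "\<bar>k - l\<bar> \<le> 1" if "\<bar>z - \<epsilon> * of_int k\<bar> \<le> \<epsilon> / 2" "\<bar>z - \<epsilon> * of_int l\<bar> \<le> \<epsilon> / 2" for z and k l :: int
  proof -
    have "\<epsilon> * \<bar>of_int (k - l)\<bar> \<le> \<epsilon> * 1"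
      using that abs_diff_mult_left[OF \<epsilon>, of "of_int k" "of_int l"] unfolding of_int_diff by linarith
    then have "\<bar>of_int (k - l) :: real\<bar> \<le> 1" using \<epsilon> by simp
    then show ?thesis by linarith
  qed
  have adjacent: "x \<in> edge \<epsilon> (\<epsilon> / 2) (k, l - k)"
    if "x \<in> cell \<epsilon> (pt \<epsilon> k)" "x \<in> cell \<epsilon> (pt \<epsilon> l)" "l - k \<in> dirs" for k l
  proof -
    have mid: "\<bar>z - \<epsilon> * (a + b / 2)\<bar> \<le> 0"
      if "\<bar>z - \<epsilon> * a\<bar> \<le> \<epsilon> / 2" "\<bar>z - \<epsilon> * (a + b)\<bar> \<le> \<epsilon> / 2" "\<bar>b\<bar> = 1" for z a b :: real
    proof -
      have "z \<le> \<epsilon> * (a + b / 2) \<and> \<epsilon> * (a + b / 2) \<le> z"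
        using that(3) unfolding abs_eq_iff'
      proof (elim conjE disjE)
        assume [simp]: "b = 1"
        show ?thesis using that(1,2) unfolding distrib_left abs_le_iff by simp
      next
        assume [simp]: "b = -1"
        show ?thesis using that(1,2) unfolding distrib_left abs_le_iff by simp
      qed
      then show ?thesis by simp
    qed
    define e where "e = l - k"
    have l: "l = k + e" by (simp add: e_def)
    have k: "\<bar>fst x - \<epsilon> * of_int (fst k)\<bar> \<le> \<epsilon> / 2" "\<bar>snd x - \<epsilon> * of_int (snd k)\<bar> \<le> \<epsilon> / 2"
      and ke: "\<bar>fst x - \<epsilon> * (of_int (fst k) + of_int (fst e))\<bar> \<le> \<epsilon> / 2"
              "\<bar>snd x - \<epsilon> * (of_int (snd k) + of_int (snd e))\<bar> \<le> \<epsilon> / 2"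
      using that(1,2) unfolding l mem_cell by simp_all
    have "e \<in> dirs" using that(3) by (simp add: e_def)
    then consider "\<bar>fst e\<bar> = 1" "snd e = 0" | "fst e = 0" "\<bar>snd e\<bar> = 1"
      by (auto simp: dirs_def)
    then show ?thesis
    proof cases
      case 1
      then have "\<bar>real_of_int (fst e)\<bar> = 1" by (simp flip: of_int_abs)
      then show ?thesis using 1 mid[OF k(1) ke(1)] k(2) unfolding e_def[symmetric] edge_def by simp
    next
      case 2
      then have "\<bar>real_of_int (snd e)\<bar> = 1" by (simp flip: of_int_abs)
      then show ?thesis using 2 mid[OF k(2) ke(2)] k(1) unfolding e_def[symmetric] edge_def by simp
    qed
  qed
  obtain i1 i2 j1 j2 where ij [simp]: "i = (i1, i2)" "j = (j1, j2)" by (metis surj_pair)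
  \<comment> \<open>Membership in a cell is checked coordinate by coordinate, so mixing the indices
    of \<open>j\<close> and \<open>i\<close> gives another cell containing \<open>x\<close>. Either
    the passage from \<open>i\<close> to \<open>m\<close> or the one from \<open>m\<close> to
    \<open>j\<close> leaves \<open>I\<close>, and it crosses a full side.\<close>
  define m where "m = (j1, i2)"
  have m: "x \<in> cell \<epsilon> (pt \<epsilon> m)" using i j by (auto simp: mem_cell m_def)
  have n: "\<bar>i1 - j1\<bar> \<le> 1" "\<bar>i2 - j2\<bar> \<le> 1" using near i j by (auto simp: mem_cell)
  have bp: "\<exists>p\<in>boundary_pairs I. x \<in> edge \<epsilon> (\<epsilon> / 2) p"
    if "k \<in> I" "l \<notin> I" "x \<in> cell \<epsilon> (pt \<epsilon> k)" "x \<in> cell \<epsilon> (pt \<epsilon> l)" "l - k \<in> dirs" for k l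
    using adjacent[OF that(3-5)] that by (intro bexI[of _ "(k, l - k)"]) (auto simp: boundary_pairs_def)
  show "x \<in> (\<Union>p\<in>boundary_pairs I. edge \<epsilon> (\<epsilon> / 2) p)"
  proof (cases "m \<in> I")
    case True
    then have "i2 \<noteq> j2" using j m_def by auto
    then have "j - m \<in> dirs" using n by (auto simp: dirs_def m_def abs_le_iff)
    then show ?thesis using bp[of m j] True j m by auto
  next
    case False
    then have "i1 \<noteq> j1" using i m_def by auto
    then have "m - i \<in> dirs" using n by (auto simp: dirs_def m_def abs_le_iff)
    then show ?thesis using bp[of i m] False i m by auto
  qed
qed

text \<open>Moving from the edge in the outward direction \<open>e\<close> by a small
  \<open>s\<close> reaches the open cell at \<open>i + e\<close>, which no other cell meets. The
  bound \<open>r < \<epsilon> / 2\<close> keeps the tangential coordinate in that open cell.\<close>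

lemma edge_subset_frontier:
  assumes \<epsilon>: "\<epsilon> > 0" and r: "r < \<epsilon> / 2" and p: "p \<in> boundary_pairs I"
  shows "edge \<epsilon> r p \<subseteq> frontier (cells \<epsilon> I)"
proof
  obtain i e where [simp]: "p = (i, e)" by (metis surj_pair)
  have ie: "i \<in> I" "e \<in> dirs" "i + e \<notin> I" using p by (auto simp: boundary_pairs_def)
  fix x assume x: "x \<in> edge \<epsilon> r p"
  then have "x \<in> edge \<epsilon> (\<epsilon> / 2) (i, e)" using edge_mono[of r "\<epsilon> / 2" \<epsilon> "(i, e)"] r by auto
  then have "x \<in> cells \<epsilon> I" using edge_subset_cells(1)[OF \<epsilon> ie(2)] ie(1) unfolding cells_def by blast
  then have "x \<in> closure (cells \<epsilon> I)" using closure_subset by blast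
  moreover have "x \<notin> interior (cells \<epsilon> I)"
  proof
    assume "x \<in> interior (cells \<epsilon> I)"
    then obtain d where d: "d > 0" "ball x d \<subseteq> cells \<epsilon> I" by (auto simp: mem_interior)
    define s where "s = min (d / 2) (\<epsilon> / 2)"
    have s: "0 < s" "s \<le> \<epsilon> / 2" "s < d" using d \<epsilon> by (auto simp: s_def)
    define y where "y = x + s *\<^sub>R (of_int (fst e), of_int (snd e))"
    have "dist x y = s" using ie(2) s by (auto simp: y_def dist_norm norm_Pair dirs_def)
    then have "y \<in> cells \<epsilon> I" using d s by auto
    then obtain j where j: "j \<in> I" "y \<in> cell \<epsilon> (pt \<epsilon> j)" by (auto simp: cells_def)
    have "j = i + e"
    proof (rule open_cell_unique[OF \<epsilon> _ _ j(2)])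
      show "\<bar>fst y - \<epsilon> * of_int (fst (i + e))\<bar> < \<epsilon> / 2" "\<bar>snd y - \<epsilon> * of_int (snd (i + e))\<bar> < \<epsilon> / 2"
        using x ie(2) s r by (auto simp: y_def edge_def dirs_def algebra_simps; linarith)+
    qed
    then show False using j ie by simp
  qed
  ultimately show "x \<in> frontier (cells \<epsilon> I)" by (simp add: frontier_def)
qed

lemma diameter_closed_segment_le:
  fixes u v :: "'a::euclidean_space"
  shows "diameter (closed_segment u v) \<le> dist u v"
proof (rule diameter_le)
  fix x y assume "x \<in> closed_segment u v" "y \<in> closed_segment u v"
  then show "norm (x - y) \<le> dist u v"
    using segment_furthest_le[of y u v x] dist_in_closed_segment[of x u v]
    by (auto simp: dist_norm)
qed simp

lemma finite_boundary_pairs: "finite I \<Longrightarrow> finite (boundary_pairs I)"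
  by (rule finite_subset[of _ "I \<times> dirs"]) (auto simp: boundary_pairs_def)

lemma hausdorff1_edge_ge:
  assumes "e \<in> dirs"
  shows "ennreal (2 * r) \<le> hausdorff1 (edge \<epsilon> r (i, e))"
proof -
  have lip: "\<bar>fst x - fst y\<bar> \<le> dist x y" "\<bar>snd x - snd y\<bar> \<le> dist x y" for x y :: "real \<times> real"
    using dist_fst_le[of x y] dist_snd_le[of x y] by (auto simp: dist_real_def)
  show ?thesis
  proof (cases "fst e = 0")
    case True
    have "ennreal ((\<epsilon> * of_int (fst i) + r) - (\<epsilon> * of_int (fst i) - r)) \<le> hausdorff1 (edge \<epsilon> r (i, e))"
      using True assms by (intro hausdorff1_ge_interval[of fst]) (auto simp: lip edge_eq_Times dirs_def)
    then show ?thesis by simp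
  next
    case False
    have "ennreal ((\<epsilon> * of_int (snd i) + r) - (\<epsilon> * of_int (snd i) - r)) \<le> hausdorff1 (edge \<epsilon> r (i, e))"
      using False assms by (intro hausdorff1_ge_interval[of snd]) (auto simp: lip edge_eq_Times dirs_def)
    then show ?thesis by simp
  qed
qed

text \<open>Below, the shortened edges are disjoint, lie in the frontier and lose an arbitrarily
  small total length. Above, the full edges cover the frontier, and cutting each into
  \<open>N\<close> segments makes the cover fine without increasing the total length.\<close>

lemma hausdorff1_frontier_cells:
  assumes \<epsilon>: "\<epsilon> > 0" and I: "finite I"
  shows "hausdorff1 (frontier (cells \<epsilon> I)) = ennreal (\<epsilon> * card (boundary_pairs I))"
proof (rule antisym)
  let ?B = "boundary_pairs I"
  have fB: "finite ?B" using I by (rule finite_boundary_pairs)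
  show "ennreal (\<epsilon> * card ?B) \<le> hausdorff1 (frontier (cells \<epsilon> I))"
  proof (rule ennreal_le_epsilon)
    fix \<eta> :: real assume \<eta>: "\<eta> > 0"
    define c where "c = real (card ?B) + 1"
    \<comment> \<open>Each edge loses at most \<open>\<eta> / c\<close>, hence all of them at most
      \<eta>. The minimum with \<open>\<epsilon> / 4\<close> keeps \<open>r\<close> positive, and
      the 1 in \<open>c\<close> covers the case of no edges.\<close>
    define r where "r = \<epsilon> / 2 - min (\<epsilon> / 4) (\<eta> / (2 * c))"
    have c: "c > 0" by (simp add: c_def)
    have r: "r < \<epsilon> / 2" "r > 0" "2 * r \<ge> \<epsilon> - \<eta> / c"
      using \<epsilon> \<eta> c by (auto simp: r_def min_def field_simps)
    have "\<epsilon> * card ?B - 2 * r * card ?B \<le> \<eta> / c * card ?B"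
      unfolding left_diff_distrib[symmetric] using r by (intro mult_right_mono) auto
    also have "\<dots> \<le> \<eta>" using c \<eta> by (simp add: field_simps c_def)
    finally have "\<epsilon> * card ?B \<le> card ?B * (2 * r) + \<eta>" by (simp add: algebra_simps)
    then have "ennreal (\<epsilon> * card ?B) \<le> ennreal (card ?B * (2 * r)) + ennreal \<eta>"
      using r \<eta> by (subst ennreal_plus[symmetric]) (auto intro!: ennreal_leI simp del: ennreal_plus)
    also have "ennreal (card ?B * (2 * r)) = (\<Sum>p\<in>?B. ennreal (2 * r))"
      using r by (simp add: ennreal_mult ennreal_of_nat_eq_real_of_nat)
    also have "\<dots> \<le> (\<Sum>p\<in>?B. hausdorff1 (edge \<epsilon> r p))"
      by (intro sum_mono) (auto simp: boundary_pairs_def intro!: hausdorff1_edge_ge)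
    also have "\<dots> \<le> hausdorff1 (\<Union>p\<in>?B. edge \<epsilon> r p)"
      by (intro hausdorff1_UN_ge fB compact_edge edge_disjoint[OF \<epsilon> r(1)])
    also have "\<dots> \<le> hausdorff1 (frontier (cells \<epsilon> I))"
      by (intro hausdorff1_mono UN_least edge_subset_frontier \<epsilon> r)
    finally show "ennreal (\<epsilon> * card ?B) \<le> hausdorff1 (frontier (cells \<epsilon> I)) + ennreal \<eta>"
      by (simp add: add_right_mono)
  qed
  show "hausdorff1 (frontier (cells \<epsilon> I)) \<le> ennreal (\<epsilon> * card ?B)"
  proof (rule hausdorff1_le[where 'i = "((int \<times> int) \<times> (int \<times> int)) \<times> nat"])
    fix \<delta> :: real assume \<delta>: "\<delta> > 0"
    obtain N :: nat where "\<epsilon> / \<delta> < N" using reals_Archimedean2 by blast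
    then have N: "N > 0" "\<epsilon> / N \<le> \<delta>"
      using \<epsilon> \<delta> by (cases "N = 0"; simp add: field_simps)+
    \<comment> \<open>One entry of \<open>e\<close> is zero, so swapping its entries gives a unit
      tangent of the edge. The parameter runs from -1/2 to 1/2 about the midpoint.\<close>
    define piece :: "((int \<times> int) \<times> (int \<times> int)) \<times> nat \<Rightarrow> (real \<times> real) set" where
      "piece = (\<lambda>((i, e), n). closed_segment
         (pt \<epsilon> i + (\<epsilon> / 2) *\<^sub>R pt 1 e + (\<epsilon> * (n / N - 1 / 2)) *\<^sub>R pt 1 (snd e, fst e))
         (pt \<epsilon> i + (\<epsilon> / 2) *\<^sub>R pt 1 e + (\<epsilon> * (Suc n / N - 1 / 2)) *\<^sub>R pt 1 (snd e, fst e)))"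
    have diam: "diameter (piece (p, n)) \<le> \<epsilon> / N" if "p \<in> ?B" for p n
    proof -
      obtain i e where [simp]: "p = (i, e)" by (metis surj_pair)
      have e: "e \<in> dirs" using that by (auto simp: boundary_pairs_def)
      have n1: "norm (pt 1 (snd e, fst e)) = 1" using e by (auto simp: dirs_def pt_def norm_Pair)
      let ?u = "pt \<epsilon> i + (\<epsilon> / 2) *\<^sub>R pt 1 e + (\<epsilon> * (n / N - 1 / 2)) *\<^sub>R pt 1 (snd e, fst e)"
      let ?v = "pt \<epsilon> i + (\<epsilon> / 2) *\<^sub>R pt 1 e + (\<epsilon> * (Suc n / N - 1 / 2)) *\<^sub>R pt 1 (snd e, fst e)"
      have "?v - ?u = (\<epsilon> * (Suc n / N - 1 / 2) - \<epsilon> * (n / N - 1 / 2)) *\<^sub>R pt 1 (snd e, fst e)"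
        unfolding scaleR_left_diff_distrib by simp
      also have "\<epsilon> * (Suc n / N - 1 / 2) - \<epsilon> * (n / N - 1 / 2) = \<epsilon> / N"
        by (simp add: algebra_simps add_divide_distrib)
      finally have "dist ?v ?u = \<epsilon> / N"
        unfolding dist_norm by (simp only: norm_scaleR n1) (use \<epsilon> in simp)
      then have "dist ?u ?v = \<epsilon> / N" by (simp only: dist_commute)
      moreover have "diameter (piece (p, n)) \<le> dist ?u ?v"
        unfolding piece_def \<open>p = (i, e)\<close> prod.case by (rule diameter_closed_segment_le)
      ultimately show ?thesis by simp
    qed
    have cover: "edge \<epsilon> (\<epsilon> / 2) p \<subseteq> (\<Union>n<N. piece (p, n))" if p: "p \<in> ?B" for p
    proof
      obtain i e where [simp]: "p = (i, e)" by (metis surj_pair)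
      have e: "e \<in> dirs" using p by (auto simp: boundary_pairs_def)
      fix x assume x: "x \<in> edge \<epsilon> (\<epsilon> / 2) p"
      define u where "u = pt \<epsilon> i + (\<epsilon> / 2) *\<^sub>R pt 1 e"
      define v where "v = pt 1 (snd e, fst e)"
      define w where "w = (x - u) \<bullet> v"
      have xw: "x = u + w *\<^sub>R v" and w: "\<bar>w\<bar> \<le> \<epsilon> / 2"
        using x e by (auto simp: edge_def dirs_def u_def v_def w_def pt_def inner_prod_def prod_eq_iff algebra_simps abs_minus_commute)
      define t where "t = w / \<epsilon> + 1 / 2"
      have t: "0 \<le> t" "t \<le> 1" "w = \<epsilon> * (t - 1 / 2)" using w \<epsilon> by (auto simp: t_def field_simps)
      have "\<exists>n<N. n / N \<le> t \<and> t \<le> Suc n / N"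
      \<comment> \<open>At the far endpoint the floor would be \<open>N\<close>, one past the last
        piece.\<close>
      proof (cases "t = 1")
        case True
        then show ?thesis using N by (intro exI[of _ "N - 1"]) (auto simp: field_simps)
      next
        case False
        define n where "n = nat \<lfloor>t * N\<rfloor>"
        have "real n \<le> t * N" "t * N < real n + 1" using t by (auto simp: n_def)
        moreover from this have "real n < N" using False t N
          by (smt (verit) mult_less_cancel_right2 of_nat_0_less_iff)
        ultimately show ?thesis using N by (intro exI[of _ n]) (auto simp: field_simps)
      qed
      then obtain n where n: "n < N" "n / N \<le> t" "t \<le> Suc n / N" by blast
      define s where "s = t * N - n"
      define a b where "a = \<epsilon> * (n / N - 1 / 2)" and "b = \<epsilon> * (Suc n / N - 1 / 2)"
      have s: "0 \<le> s" "s \<le> 1" using n N by (auto simp: s_def field_simps)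
      have "t = (1 - s) * (n / N) + s * (Suc n / N)" using N by (simp add: s_def field_simps)
      then have "w = (1 - s) * a + s * b"
        unfolding t(3) a_def b_def by (simp add: field_simps)
      then have "x = (1 - s) *\<^sub>R (u + a *\<^sub>R v) + s *\<^sub>R (u + b *\<^sub>R v)"
        unfolding xw by (simp only: scaleR_add_right scaleR_scaleR scaleR_left_diff_distrib
            scaleR_add_left scaleR_one) (simp add: algebra_simps)
      then have "x \<in> piece (p, n)"
        using s by (auto simp: piece_def u_def v_def a_def b_def in_segment intro!: exI[of _ s])
      then show "x \<in> (\<Union>n<N. piece (p, n))" using n by auto
    qed
    have "frontier (cells \<epsilon> I) \<subseteq> (\<Union>t\<in>?B \<times> {..<N}. piece t)"
      using frontier_cells_subset[OF \<epsilon> I] cover by fastforce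
    moreover have "(\<Sum>t\<in>?B \<times> {..<N}. diameter (piece t)) \<le> (\<Sum>t\<in>?B \<times> {..<N}. \<epsilon> / N)"
      by (intro sum_mono) (auto intro: diam)
    then have "(\<Sum>t\<in>?B \<times> {..<N}. diameter (piece t)) \<le> \<epsilon> * card ?B"
      using N by (simp add: card_cartesian_product mult.commute)
    moreover have "\<forall>t\<in>?B \<times> {..<N}. bounded (piece t) \<and> diameter (piece t) \<le> \<delta>"
    proof (clarify, intro conjI)
      fix i e n assume p: "(i, e) \<in> ?B"
      show "bounded (piece ((i, e), n))" by (simp add: piece_def bounded_closed_segment)
      show "diameter (piece ((i, e), n)) \<le> \<delta>" using diam[OF p, of n] N(2) by linarith
    qed
    ultimately show "\<exists>(T :: (((int \<times> int) \<times> (int \<times> int)) \<times> nat) set) U. finite T \<and> frontier (cells \<epsilon> I) \<subseteq> (\<Union>t\<in>T. U t) \<and>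
             (\<forall>t\<in>T. bounded (U t) \<and> diameter (U t) \<le> \<delta>) \<and> (\<Sum>t\<in>T. diameter (U t)) \<le> \<epsilon> * card ?B"
      using fB by (intro exI[of _ "?B \<times> {..<N}"] exI[of _ piece]) auto
  qed
qed

section \<open>Perimeter of unions of cells\<close>

lemma C1_divergence_continuous:
  "C1_compact_support T \<Longrightarrow> continuous_on UNIV (divergence T)"
  unfolding C1_compact_support_def divergence_def
  by (intro continuous_intros) blast

text \<open>The divergence theorem on a rectangle: Fubini and the fundamental theorem of calculus
  reduce each partial derivative to differences of a component of \<open>T\<close> on opposite
  sides, and these are at most 2.\<close>

lemma integral_divergence_box:
  fixes T :: "real \<times> real \<Rightarrow> real \<times> real"
  assumes T: "C1_compact_support T" and bd: "\<And>x. norm (T x) \<le> 1" and ab: "a \<le> b" "c \<le> d"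
  shows "integral (cbox (a, c) (b, d)) (divergence T) \<le> 2 * (b - a) + 2 * (d - c)"
proof -
  define D where "D v x = frechet_derivative T (at x) v" for v x
  have der: "(T has_derivative frechet_derivative T (at x)) (at x)" for x
    using T unfolding C1_compact_support_def by (blast intro: frechet_derivative_works[THEN iffD1])
  have cont: "continuous_on S (D v)" if "v \<in> Basis" for v S
    using T that by (auto simp: C1_compact_support_def D_def intro: continuous_on_subset)
  have B: "(1, 0) \<in> (Basis :: (real \<times> real) set)" "(0, 1) \<in> (Basis :: (real \<times> real) set)"
    by (auto simp: Basis_prod_def)
  have div: "divergence T x = fst (D (1, 0) x) + snd (D (0, 1) x)" for x
    by (simp add: divergence_def D_def Basis_prod_def inner_prod_def sum.union_disjoint)
  have line: "((\<lambda>s. T (s, y)) has_vector_derivative D (1, 0) (s, y)) (at s within S)"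
             "((\<lambda>s. T (y, s)) has_vector_derivative D (0, 1) (y, s)) (at s within S)" for s y S
  proof -
    show "((\<lambda>s. T (s, y)) has_vector_derivative D (1, 0) (s, y)) (at s within S)"
    proof -
      have 1: "((\<lambda>s. (s, y)) has_derivative (\<lambda>h. (h, 0))) (at s within S)"
        by (rule has_derivative_Pair[OF has_derivative_ident has_derivative_const])
      have 2: "(T has_derivative frechet_derivative T (at (s, y))) (at (s, y))" by (rule der)
      have "frechet_derivative T (at (s, y)) (h, 0) = h *\<^sub>R D (1, 0) (s, y)" for h
        using linear_scale[OF has_derivative_linear[OF 2], of h "(1, 0)"] by (simp add: D_def)
      then show ?thesis
        using has_derivative_compose[OF 1 2] by (simp add: has_vector_derivative_def)
    qed
    show "((\<lambda>s. T (y, s)) has_vector_derivative D (0, 1) (y, s)) (at s within S)"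
    proof -
      have 1: "((\<lambda>s. (y, s)) has_derivative (\<lambda>h. (0, h))) (at s within S)"
        by (rule has_derivative_Pair[OF has_derivative_const has_derivative_ident])
      have 2: "(T has_derivative frechet_derivative T (at (y, s))) (at (y, s))" by (rule der)
      have "frechet_derivative T (at (y, s)) (0, h) = h *\<^sub>R D (0, 1) (y, s)" for h
        using linear_scale[OF has_derivative_linear[OF 2], of h "(0, 1)"] by (simp add: D_def)
      then show ?thesis
        using has_derivative_compose[OF 1 2] by (simp add: has_vector_derivative_def)
    qed
  qed
  have le1: "\<bar>fst (T x)\<bar> \<le> 1" "\<bar>snd (T x)\<bar> \<le> 1" for x
    using bd[of x] norm_fst_le[of "fst (T x)" "snd (T x)"] norm_snd_le[of "snd (T x)" "fst (T x)"]
    by (auto intro: order_trans)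
  have c1: "continuous_on S (\<lambda>x. fst (D (1, 0) x))" and c2: "continuous_on S (\<lambda>x. snd (D (0, 1) x))" for S
    using cont B by (auto intro!: continuous_intros)
  have i1: "integral (cbox a b) (\<lambda>s. fst (D (1, 0) (s, y))) \<le> 2" for y
  proof -
    have "((\<lambda>s. fst (D (1, 0) (s, y))) has_integral fst (T (b, y)) - fst (T (a, y))) {a..b}"
      by (rule fundamental_theorem_of_calculus)
         (use ab line(1) in \<open>auto intro!: bounded_linear.has_vector_derivative[OF bounded_linear_fst]\<close>)
    then show ?thesis using le1(1)[of "(a, y)"] le1(1)[of "(b, y)"] by (simp add: integral_unique)
  qed
  have i2: "integral (cbox c d) (\<lambda>s. snd (D (0, 1) (y, s))) \<le> 2" for y
  proof -
    have "((\<lambda>s. snd (D (0, 1) (y, s))) has_integral snd (T (y, d)) - snd (T (y, c))) {c..d}"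
      by (rule fundamental_theorem_of_calculus)
         (use ab line(2) in \<open>auto intro!: bounded_linear.has_vector_derivative[OF bounded_linear_snd]\<close>)
    then show ?thesis using le1(2)[of "(y, c)"] le1(2)[of "(y, d)"] by (simp add: integral_unique)
  qed
  have const: "integral (cbox u v) f \<le> 2 * (v - u)"
    if "continuous_on (cbox u v) f" "\<And>y. f y \<le> 2" "u \<le> v" for f and u v :: real
  proof -
    have "integral (cbox u v) f \<le> integral (cbox u v) (\<lambda>_. 2 :: real)"
      using that by (intro integral_le integrable_continuous) auto
    then show ?thesis using that by simp
  qed
  have "integral (cbox (a, c) (b, d)) (\<lambda>x. snd (D (0, 1) x)) =
        integral (cbox a b) (\<lambda>y. integral (cbox c d) (\<lambda>s. snd (D (0, 1) (y, s))))"
    by (rule integral_prod_continuous[OF c2])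
  also have "\<dots> \<le> 2 * (b - a)"
    using c2 i2 ab by (intro const integral_continuous_on_param) (auto simp: case_prod_unfold)
  finally have 2: "integral (cbox (a, c) (b, d)) (\<lambda>x. snd (D (0, 1) x)) \<le> 2 * (b - a)" .
  have "integral (cbox (a, c) (b, d)) (\<lambda>x. fst (D (1, 0) x)) =
        integral (cbox a b) (\<lambda>s. integral (cbox c d) (\<lambda>y. fst (D (1, 0) (s, y))))"
    by (rule integral_prod_continuous[OF c1])
  \<comment> \<open>The inner integral has to run in the direction of differentiation.\<close>
  also have "\<dots> = integral (cbox c d) (\<lambda>y. integral (cbox a b) (\<lambda>s. fst (D (1, 0) (s, y))))"
    using c1 by (intro integral_swap_continuous) (auto simp: case_prod_unfold)
  also have "\<dots> \<le> 2 * (d - c)"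
  proof (intro const integral_continuous_on_param i1 ab)
    show "continuous_on (cbox c d \<times> cbox a b) (\<lambda>(y, s). fst (D (1, 0) (s, y)))"
      unfolding case_prod_unfold
      by (rule continuous_on_compose2[OF c1[of UNIV], of _ "\<lambda>z. (snd z, fst z)"]) (auto intro!: continuous_intros)
  qed
  finally have 1: "integral (cbox (a, c) (b, d)) (\<lambda>x. fst (D (1, 0) x)) \<le> 2 * (d - c)" .
  have "integral (cbox (a, c) (b, d)) (divergence T) =
        integral (cbox (a, c) (b, d)) (\<lambda>x. fst (D (1, 0) x)) + integral (cbox (a, c) (b, d)) (\<lambda>x. snd (D (0, 1) x))"
    unfolding div by (intro integral_add integrable_continuous c1 c2)
  then show ?thesis using 1 2 by linarith
qed

lemma cell_eq_cbox:
  "cell \<epsilon> (pt \<epsilon> i) = cbox (\<epsilon> * of_int (fst i) - \<epsilon> / 2, \<epsilon> * of_int (snd i) - \<epsilon> / 2)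
                          (\<epsilon> * of_int (fst i) + \<epsilon> / 2, \<epsilon> * of_int (snd i) + \<epsilon> / 2)"
  by (simp add: cell_eq_Times cbox_Pair_eq)

text \<open>The overlap misses the interior of the first cell, and the frontier of a convex set is
  negligible.\<close>

lemma negligible_cell_Int:
  assumes "\<epsilon> > 0" "i \<noteq> j"
  shows "negligible (cell \<epsilon> (pt \<epsilon> i) \<inter> cell \<epsilon> (pt \<epsilon> j))"
proof (rule negligible_subset)
  let ?C = "cell \<epsilon> (pt \<epsilon> i)"
  show "negligible (frontier ?C)"
    by (simp add: cell_eq_cbox negligible_convex_frontier)
  show "?C \<inter> cell \<epsilon> (pt \<epsilon> j) \<subseteq> frontier ?C"
  proof
    fix x assume x: "x \<in> ?C \<inter> cell \<epsilon> (pt \<epsilon> j)"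
    have "x \<notin> interior ?C"
    proof
      assume "x \<in> interior ?C"
      then have b: "\<epsilon> * of_int (fst i) - \<epsilon> / 2 < fst x" "fst x < \<epsilon> * of_int (fst i) + \<epsilon> / 2"
          "\<epsilon> * of_int (snd i) - \<epsilon> / 2 < snd x" "snd x < \<epsilon> * of_int (snd i) + \<epsilon> / 2"
        unfolding cell_eq_cbox interior_cbox
        by (simp_all add: mem_box Basis_prod_def ball_Un inner_prod_def)
      have "\<bar>fst x - \<epsilon> * of_int (fst i)\<bar> < \<epsilon> / 2" "\<bar>snd x - \<epsilon> * of_int (snd i)\<bar> < \<epsilon> / 2"
        using b by linarith+
      then show False using open_cell_unique[OF assms(1), of x i j] x assms(2) by auto
    qed
    then show "x \<in> frontier ?C" using x closure_subset[of ?C] by (auto simp: frontier_def)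
  qed
qed

text \<open>Summing the bound for single cells ignores the cancellation on common sides, but
  finiteness is all that makes a finite union an admissible competitor.\<close>

lemma finite_perimeter_cells:
  assumes \<epsilon>: "\<epsilon> > 0" and I: "finite I"
  shows "finite_perimeter (cells \<epsilon> I)"
  unfolding finite_perimeter_def
proof
  have comp: "compact (cells \<epsilon> I)" by (rule compact_cells[OF I])
  show "cells \<epsilon> I \<in> sets lebesgue" using comp by (simp add: borel_compact lmeasurable_compact fmeasurableD)
  have "(LINT x:cells \<epsilon> I|lebesgue. divergence T x) \<le> card I * (4 * \<epsilon>)"
    if T: "C1_compact_support T" "\<And>x. norm (T x) \<le> 1" for T :: "real \<times> real \<Rightarrow> real \<times> real"
  proof -
    have cont: "continuous_on S (divergence T)" for S
      using C1_divergence_continuous[OF T(1)] continuous_on_subset by blast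
    have "set_integrable lborel (cells \<epsilon> I) (divergence T)"
      using comp cont by (rule borel_integrable_compact[folded set_integrable_def])
    then have "set_integrable lebesgue (cells \<epsilon> I) (divergence T)"
      unfolding set_integrable_def by (subst integrable_completion) (auto dest: borel_measurable_integrable)
    then have "(LINT x:cells \<epsilon> I|lebesgue. divergence T x) = integral (cells \<epsilon> I) (divergence T)"
      by (rule set_lebesgue_integral_eq_integral)
    also have "\<dots> = (\<Sum>i\<in>I. integral (cell \<epsilon> (pt \<epsilon> i)) (divergence T))"
      unfolding cells_def
    proof (intro integral_unique has_integral_UN I integrable_integral)
      show "divergence T integrable_on cell \<epsilon> (pt \<epsilon> i)" for i
        unfolding cell_eq_cbox by (intro integrable_continuous cont)
      show "pairwise (\<lambda>i j. negligible (cell \<epsilon> (pt \<epsilon> i) \<inter> cell \<epsilon> (pt \<epsilon> j))) I"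
        unfolding pairwise_def using negligible_cell_Int[OF \<epsilon>] by blast
    qed
    also have "\<dots> \<le> (\<Sum>i\<in>I. 4 * \<epsilon>)"
      unfolding cell_eq_cbox using \<epsilon>
      by (intro sum_mono order_trans[OF integral_divergence_box[OF T]]) auto
    finally show ?thesis by simp
  qed
  then have "perimeter (cells \<epsilon> I) \<le> ereal (card I * (4 * \<epsilon>))"
    unfolding perimeter_def by (intro SUP_least) auto
  then show "perimeter (cells \<epsilon> I) < \<infinity>" by (rule le_less_trans) simp
qed

text \<open>The integrals that define the perimeter do not see a null set. Countable sets are
  thereby admissible values of a movement.\<close>

lemma finite_perimeter_countable:
  assumes "countable X"
  shows "finite_perimeter X"
proof -
  have N: "X \<in> null_sets lebesgue"
    using countable_imp_null_set_lborel[OF assms] by (rule null_sets_completionI)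
  have "(LINT x:X|lebesgue. divergence T x) = 0" for T :: "'a \<Rightarrow> 'a"
    unfolding set_lebesgue_integral_def
    using AE_not_in[OF N] by (intro integral_eq_zero_AE) (auto elim!: eventually_mono)
  then have "perimeter X \<le> 0" unfolding perimeter_def by (intro SUP_least) (simp add: zero_ereal_def)
  then show ?thesis using N unfolding finite_perimeter_def by (auto intro: le_less_trans)
qed

section \<open>The energy on the lattice\<close>

locale absolute_norm =
  fixes \<phi> :: "real \<times> real \<Rightarrow> real"
  assumes norm: "is_norm \<phi>" and abs: "absolute \<phi>" and normal: "normalized \<phi>"
begin

lemma nonneg [simp]: "0 \<le> \<phi> x" and scale: "\<phi> (c *\<^sub>R x) = \<bar>c\<bar> * \<phi> x"
  and triangle: "\<phi> (x + y) \<le> \<phi> x + \<phi> y"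
  using norm unfolding is_norm_def by blast+

lemma abs_eq: "\<bar>fst x\<bar> = \<bar>fst y\<bar> \<Longrightarrow> \<bar>snd x\<bar> = \<bar>snd y\<bar> \<Longrightarrow> \<phi> x = \<phi> y"
  using abs unfolding absolute_def by blast

text \<open>The point \<open>(a, y)\<close> lies on the segment between \<open>(b, y)\<close> and
  its reflection \<open>(- b, y)\<close>, which have equal norm; \<open>t\<close> is the weight with
  \<open>t * b - (1 - t) * b = a\<close>.\<close>

lemma mono_fst: "\<bar>a\<bar> \<le> \<bar>b\<bar> \<Longrightarrow> \<phi> (a, y) \<le> \<phi> (b, y)"
proof (cases "b = 0")
  case False
  assume ab: "\<bar>a\<bar> \<le> \<bar>b\<bar>"
  define r where "r = a / b"
  have r: "a = r * b" "\<bar>r\<bar> \<le> 1" using ab False by (auto simp: r_def abs_divide)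
  define t where "t = (1 + r) / 2"
  have t: "0 \<le> t" "t \<le> 1" using r(2) unfolding t_def by (auto simp: abs_le_iff)
  have eq: "(a, y) = t *\<^sub>R (b, y) + (1 - t) *\<^sub>R (- b, y)"
    by (simp add: t_def r(1) field_simps)
  have "\<phi> (a, y) \<le> t * \<phi> (b, y) + (1 - t) * \<phi> (- b, y)"
    unfolding eq using triangle[of "t *\<^sub>R (b, y)" "(1 - t) *\<^sub>R (- b, y)"] t by (simp only: scale)
  also have "\<phi> (- b, y) = \<phi> (b, y)" by (rule abs_eq) simp_all
  finally show ?thesis by (simp add: algebra_simps)
qed auto

lemma mono_snd: "\<bar>a\<bar> \<le> \<bar>b\<bar> \<Longrightarrow> \<phi> (y, a) \<le> \<phi> (y, b)"
proof (cases "b = 0")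
  case False
  assume ab: "\<bar>a\<bar> \<le> \<bar>b\<bar>"
  define r where "r = a / b"
  have r: "a = r * b" "\<bar>r\<bar> \<le> 1" using ab False by (auto simp: r_def abs_divide)
  define t where "t = (1 + r) / 2"
  have t: "0 \<le> t" "t \<le> 1" using r(2) unfolding t_def by (auto simp: abs_le_iff)
  have eq: "(y, a) = t *\<^sub>R (y, b) + (1 - t) *\<^sub>R (y, - b)"
    by (simp add: t_def r(1) field_simps)
  have "\<phi> (y, a) \<le> t * \<phi> (y, b) + (1 - t) * \<phi> (y, - b)"
    unfolding eq using triangle[of "t *\<^sub>R (y, b)" "(1 - t) *\<^sub>R (y, - b)"] t by (simp only: scale)
  also have "\<phi> (y, - b) = \<phi> (y, b)" by (rule abs_eq) simp_all
  finally show ?thesis by (simp add: algebra_simps)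
qed auto

lemma mono: "\<bar>a\<bar> \<le> \<bar>c\<bar> \<Longrightarrow> \<bar>b\<bar> \<le> \<bar>d\<bar> \<Longrightarrow> \<phi> (a, b) \<le> \<phi> (c, d)"
  using mono_fst mono_snd order_trans by blast

lemma axis: "\<phi> (a, 0) = \<bar>a\<bar>" "\<phi> (0, a) = \<bar>a\<bar>"
  using scale[of a "(1, 0)"] scale[of a "(0, 1)"] normal by (auto simp: normalized_def)

lemma ge_abs_fst: "\<bar>fst x\<bar> \<le> \<phi> x" and ge_abs_snd: "\<bar>snd x\<bar> \<le> \<phi> x"
  using mono[of "fst x" "fst x" 0 "snd x"] mono[of 0 "fst x" "snd x" "snd x"] by (auto simp: axis)

lemma diag_le_2: "\<phi> (1, 1) \<le> 2" and diag_pos: "\<phi> (1, 1) > 0"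
  using triangle[of "(1, 0)" "(0, 1)"] axis(1)[of 1] axis(2)[of 1] ge_abs_fst[of "(1, 1)"] by auto

text \<open>A vector with two nonzero entries dominates \<open>(1, 1)\<close> entrywise. A remaining
  vector on an axis has an entry of modulus at least 2, which is at least \<phi>(1, 1).\<close>

lemma pt_ge_diag:
  assumes "i \<noteq> 0" "i \<notin> dirs"
  shows "\<phi> (1, 1) \<le> \<phi> (pt 1 i)"
proof (cases "fst i = 0 \<or> snd i = 0")
  case True
  then have "2 \<le> \<bar>fst i\<bar> \<or> 2 \<le> \<bar>snd i\<bar>"
    using assms by (cases i) (auto simp: dirs_def zero_prod_def)
  then have "2 \<le> \<bar>real_of_int (fst i)\<bar> \<or> 2 \<le> \<bar>real_of_int (snd i)\<bar>" by linarith
  then have "2 \<le> \<phi> (pt 1 i)"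
    using ge_abs_fst[of "pt 1 i"] ge_abs_snd[of "pt 1 i"] by (auto simp: pt_def)
  then show ?thesis using diag_le_2 by linarith
next
  case False
  then have "\<bar>1 :: real\<bar> \<le> \<bar>of_int (fst i)\<bar>" "\<bar>1 :: real\<bar> \<le> \<bar>of_int (snd i)\<bar>" by linarith+
  then show ?thesis unfolding pt_def by (intro mono) auto
qed

lemma pt_dirs: "i \<in> dirs \<Longrightarrow> \<phi> (pt 1 i) = 1"
  by (auto simp: dirs_def pt_def axis)

lemma pt_ge_1: "i \<noteq> 0 \<Longrightarrow> 1 \<le> \<phi> (pt 1 i)"
  using pt_dirs[of i] pt_ge_diag[of i] ge_abs_fst[of "(1, 1)"] by (cases "i \<in> dirs") auto

lemma pt_diff: "\<epsilon> > 0 \<Longrightarrow> \<phi> (pt \<epsilon> i - pt \<epsilon> j) = \<epsilon> * \<phi> (pt 1 (i - j))"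
  using scale[of \<epsilon> "pt 1 (i - j)"] by (simp add: pt_def right_diff_distrib)

text \<open>A minimum suffices because the sets of the scheme are finite and nonempty. Only the
  distance from outside is kept: growth is monotone, so the sum runs over
  \<open>I - J\<close>.\<close>

definition dist_to :: "(int \<times> int) set \<Rightarrow> int \<times> int \<Rightarrow> real" where
  "dist_to J i = Min ((\<lambda>j. \<phi> (pt 1 (i - j))) ` J)"

definition step_energy :: "real \<Rightarrow> (int \<times> int) set \<Rightarrow> (int \<times> int) set \<Rightarrow> real" where
  "step_energy \<alpha> J I = \<alpha> * (\<Sum>i\<in>I - J. dist_to J i) - card (boundary_pairs I)"

text \<open>Restricting to finite competitors is justified by
  \<open>is_arg_min_energy_iff\<close>.\<close>

definition minimal_step :: "real \<Rightarrow> (int \<times> int) set \<Rightarrow> (int \<times> int) set \<Rightarrow> bool" where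
  "minimal_step \<alpha> J I \<longleftrightarrow> finite I \<and> J \<subseteq> I \<and>
     (\<forall>I'. finite I' \<longrightarrow> J \<subseteq> I' \<longrightarrow> step_energy \<alpha> J I \<le> step_energy \<alpha> J I')"

lemma dist_to_le: "finite J \<Longrightarrow> j \<in> J \<Longrightarrow> dist_to J i \<le> \<phi> (pt 1 (i - j))"
  unfolding dist_to_def by (intro Min_le) auto

lemma dist_to_attained:
  assumes "finite J" "J \<noteq> {}" obtains j where "j \<in> J" "dist_to J i = \<phi> (pt 1 (i - j))"
  using Min_in[of "(\<lambda>j. \<phi> (pt 1 (i - j))) ` J"] assms unfolding dist_to_def by (auto simp del: Min_in)

lemma dist_to_nonneg: "finite J \<Longrightarrow> J \<noteq> {} \<Longrightarrow> 0 \<le> dist_to J i"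
  by (rule dist_to_attained[of J i]) auto

end

section \<open>Correspondence between unions of cells and their index sets\<close>

lemma inj_pt: "\<epsilon> > 0 \<Longrightarrow> inj_on (pt \<epsilon>) S"
  by (auto simp: inj_on_def pt_def prod_eq_iff)

lemma lattice_eq_range: "lattice \<epsilon> = range (pt \<epsilon>)"
  by (force simp: lattice_def pt_def image_iff)

text \<open>A centre is interior to its own cell, so no other cell contains it. This is what allows
  an index set to be recovered from its union of cells.\<close>

lemma pt_in_cells_iff:
  assumes "\<epsilon> > 0" shows "pt \<epsilon> k \<in> cells \<epsilon> I \<longleftrightarrow> k \<in> I"
proof
  assume "pt \<epsilon> k \<in> cells \<epsilon> I"
  then obtain i where "i \<in> I" "pt \<epsilon> k \<in> cell \<epsilon> (pt \<epsilon> i)" by (auto simp: cells_def)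
  then show "k \<in> I"
    using open_cell_unique[OF assms, of "pt \<epsilon> k" k i] assms by (auto simp: pt_def)
next
  have "pt \<epsilon> k \<in> cell \<epsilon> (pt \<epsilon> k)" unfolding mem_cell using assms by (simp add: pt_def)
  then show "k \<in> I \<Longrightarrow> pt \<epsilon> k \<in> cells \<epsilon> I" unfolding cells_def by blast
qed

lemma centers_cells: "\<epsilon> > 0 \<Longrightarrow> centers \<epsilon> (cells \<epsilon> I) = pt \<epsilon> ` I"
  using pt_in_cells_iff by (auto simp: centers_def lattice_eq_range)

lemma cells_subset_iff:
  assumes "\<epsilon> > 0" shows "cells \<epsilon> I \<subseteq> cells \<epsilon> J \<longleftrightarrow> I \<subseteq> J"
proof
  assume "cells \<epsilon> I \<subseteq> cells \<epsilon> J"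
  then show "I \<subseteq> J" using pt_in_cells_iff[OF assms] by (metis subset_eq)
qed (auto simp: cells_def)

lemma discrete_sets_eq: "discrete_sets \<epsilon> = range (cells \<epsilon>)"
proof (intro equalityI subsetI)
  fix A assume "A \<in> discrete_sets \<epsilon>"
  then obtain I where I: "A = (\<Union>i\<in>I. cell \<epsilon> i)" "I \<subseteq> range (pt \<epsilon>)"
    unfolding discrete_sets_def lattice_eq_range by blast
  then obtain J where "I = pt \<epsilon> ` J" by (auto simp: subset_image_iff)
  then have "A = cells \<epsilon> J" using I(1) by (simp add: cells_def)
  then show "A \<in> range (cells \<epsilon>)" by (rule range_eqI)
next
  fix A assume "A \<in> range (cells \<epsilon>)"
  then obtain J where "A = cells \<epsilon> J" by (rule rangeE)
  then have "A = (\<Union>i\<in>pt \<epsilon> ` J. cell \<epsilon> i)" by (simp add: cells_def)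
  then show "A \<in> discrete_sets \<epsilon>" unfolding discrete_sets_def lattice_eq_range by blast
qed

context absolute_norm
begin

lemma discrete_dist_eq:
  assumes \<epsilon>: "\<epsilon> > 0" and J: "finite J" "J \<noteq> {}" and i: "i \<notin> J"
  shows "discrete_dist \<phi> \<epsilon> (pt \<epsilon> i) (pt \<epsilon> ` J) = ennreal (\<epsilon> * dist_to J i)"
proof -
  have "pt \<epsilon> i \<notin> pt \<epsilon> ` J" using i inj_pt[OF \<epsilon>, of UNIV] by (auto dest: injD)
  then have "discrete_dist \<phi> \<epsilon> (pt \<epsilon> i) (pt \<epsilon> ` J) = (INF j\<in>J. ennreal (\<epsilon> * \<phi> (pt 1 (i - j))))"
    by (simp add: discrete_dist_def image_image pt_diff[OF \<epsilon>])
  also have "\<dots> = ennreal (\<epsilon> * dist_to J i)"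
  proof (rule antisym)
    obtain j where "j \<in> J" "dist_to J i = \<phi> (pt 1 (i - j))" using dist_to_attained[OF J] .
    then show "(INF j\<in>J. ennreal (\<epsilon> * \<phi> (pt 1 (i - j)))) \<le> ennreal (\<epsilon> * dist_to J i)"
      by (intro INF_lower2[of j]) auto
    show "ennreal (\<epsilon> * dist_to J i) \<le> (INF j\<in>J. ennreal (\<epsilon> * \<phi> (pt 1 (i - j))))"
      using \<epsilon> J by (intro INF_greatest ennreal_leI mult_left_mono dist_to_le) auto
  qed
  finally show ?thesis .
qed

lemma sym_diff_centers:
  "\<epsilon> > 0 \<Longrightarrow> J \<subseteq> I \<Longrightarrow> sym_diff (centers \<epsilon> (cells \<epsilon> I)) (centers \<epsilon> (cells \<epsilon> J)) = pt \<epsilon> ` (I - J)"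
  using inj_pt[of \<epsilon> UNIV] by (auto simp: centers_cells dest: injD)

text \<open>Both terms carry \<epsilon> squared: length and its prefactor give one factor each, and
  the dissipation weight times a distance scaled by \<epsilon> leaves the ratio
  \<open>\<epsilon> / \<tau>\<close>.\<close>

lemma energy_finite:
  assumes \<epsilon>: "\<epsilon> > 0" and \<tau>: "\<tau> > 0" and J: "finite J" "J \<noteq> {}" and I: "finite I" "J \<subseteq> I"
  shows "energy \<phi> \<epsilon> \<tau> (cells \<epsilon> I) (cells \<epsilon> J) = ereal (\<epsilon>\<^sup>2 * step_energy (\<epsilon> / \<tau>) J I)"
proof -
  have "(\<Sum>\<^sub>\<infinity>i\<in>sym_diff (centers \<epsilon> (cells \<epsilon> I)) (centers \<epsilon> (cells \<epsilon> J)). discrete_dist \<phi> \<epsilon> i (centers \<epsilon> (cells \<epsilon> J)))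
      = (\<Sum>i\<in>pt \<epsilon> ` (I - J). discrete_dist \<phi> \<epsilon> i (pt \<epsilon> ` J))"
    unfolding sym_diff_centers[OF \<epsilon> I(2)] unfolding centers_cells[OF \<epsilon>] using I by simp
  also have "\<dots> = (\<Sum>i\<in>I - J. discrete_dist \<phi> \<epsilon> (pt \<epsilon> i) (pt \<epsilon> ` J))"
    by (simp add: sum.reindex[OF inj_pt[OF \<epsilon>]])
  also have "\<dots> = (\<Sum>i\<in>I - J. ennreal (\<epsilon> * dist_to J i))"
    by (intro sum.cong discrete_dist_eq[OF \<epsilon> J]) auto
  also have "\<dots> = ennreal (\<Sum>i\<in>I - J. \<epsilon> * dist_to J i)"
    using dist_to_nonneg[OF J] \<epsilon> by (intro sum_ennreal) auto
  finally have s: "enn2ereal (\<Sum>\<^sub>\<infinity>i\<in>sym_diff (centers \<epsilon> (cells \<epsilon> I)) (centers \<epsilon> (cells \<epsilon> J)). discrete_dist \<phi> \<epsilon> i (centers \<epsilon> (cells \<epsilon> J)))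
      = ereal (\<Sum>i\<in>I - J. \<epsilon> * dist_to J i)"
    using dist_to_nonneg[OF J] \<epsilon> by (simp add: enn2ereal_ennreal sum_nonneg)
  have h: "enn2ereal (hausdorff1 (frontier (cells \<epsilon> I))) = ereal (\<epsilon> * card (boundary_pairs I))"
    using \<epsilon> by (simp add: hausdorff1_frontier_cells[OF \<epsilon> I(1)] enn2ereal_ennreal)
  show ?thesis
    unfolding energy_def s h using \<tau>
    by (simp add: step_energy_def sum_distrib_left[symmetric] power2_eq_square field_simps)
qed

text \<open>Every added cell is at distance at least \<epsilon> from \<open>J\<close>, so infinitely
  many of them have infinite dissipation.\<close>

lemma energy_infinite:
  assumes \<epsilon>: "\<epsilon> > 0" and \<tau>: "\<tau> > 0" and J: "finite J" and I: "infinite I" "J \<subseteq> I"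
  shows "energy \<phi> \<epsilon> \<tau> (cells \<epsilon> I) (cells \<epsilon> J) = \<infinity>"
proof -
  have "infsum (\<lambda>i. discrete_dist \<phi> \<epsilon> i (pt \<epsilon> ` J)) (pt \<epsilon> ` (I - J)) = \<infinity>"
  proof (rule infsum_superconst_infinite_ennreal[of _ "ennreal \<epsilon>"])
    show "infinite (pt \<epsilon> ` (I - J))"
      using I(1) J by (simp add: finite_image_iff[OF inj_pt[OF \<epsilon>]])
    fix x assume "x \<in> pt \<epsilon> ` (I - J)"
    then obtain i where i: "i \<in> I - J" "x = pt \<epsilon> i" by auto
    have "x \<notin> pt \<epsilon> ` J" using i inj_pt[OF \<epsilon>, of UNIV] by (auto dest: injD)
    moreover have "\<epsilon> \<le> \<phi> (pt \<epsilon> i - pt \<epsilon> j)" if "j \<in> J" for j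
      unfolding pt_diff[OF \<epsilon>] using pt_ge_1[of "i - j"] that i \<epsilon> by (cases "i = j") auto
    ultimately show "ennreal \<epsilon> \<le> discrete_dist \<phi> \<epsilon> x (pt \<epsilon> ` J)"
      using i by (auto simp: discrete_dist_def intro!: INF_greatest ennreal_leI)
  qed (use \<epsilon> in simp)
  then have "enn2ereal (\<Sum>\<^sub>\<infinity>i\<in>sym_diff (centers \<epsilon> (cells \<epsilon> I)) (centers \<epsilon> (cells \<epsilon> J)). discrete_dist \<phi> \<epsilon> i (centers \<epsilon> (cells \<epsilon> J))) = \<infinity>"
    unfolding sym_diff_centers[OF \<epsilon> I(2)] unfolding centers_cells[OF \<epsilon>] by simp
  \<comment> \<open>In \<open>ereal\<close> adding infinity always gives infinity, so the length of
    the frontier need not be known here.\<close>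
  then show ?thesis
    unfolding energy_def using \<epsilon> \<tau> by simp
qed

text \<open>The set \<open>J\<close> itself competes with finite energy, which rules out infinite
  minimizers; among finite sets the energy is a positive multiple of
  \<open>step_energy\<close>.\<close>

lemma is_arg_min_energy_iff:
  assumes \<epsilon>: "\<epsilon> > 0" and \<tau>: "\<tau> > 0" and J: "finite J" "J \<noteq> {}"
  shows "is_arg_min (\<lambda>A. energy \<phi> \<epsilon> \<tau> A (cells \<epsilon> J))
            (\<lambda>A. A \<in> discrete_sets \<epsilon> \<and> finite_perimeter A \<and> cells \<epsilon> J \<subseteq> A) A \<longleftrightarrow>
         (\<exists>I. A = cells \<epsilon> I \<and> minimal_step (\<epsilon> / \<tau>) J I)"
    (is "is_arg_min ?f ?P A \<longleftrightarrow> ?R")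
proof
  have e2: "\<epsilon>\<^sup>2 > 0" using \<epsilon> by simp
  assume min: "is_arg_min ?f ?P A"
  then have A: "A \<in> discrete_sets \<epsilon>" "cells \<epsilon> J \<subseteq> A" and le: "\<And>B. ?P B \<Longrightarrow> ?f A \<le> ?f B"
    by (auto simp: is_arg_min_def not_less)
  obtain I where I: "A = cells \<epsilon> I" "J \<subseteq> I"
    using A cells_subset_iff[OF \<epsilon>] by (auto simp: discrete_sets_eq)
  have le': "?f A \<le> ?f (cells \<epsilon> I')" if "finite I'" "J \<subseteq> I'" for I'
    using that cells_subset_iff[OF \<epsilon>] finite_perimeter_cells[OF \<epsilon>]
    by (intro le) (auto simp: discrete_sets_eq)
  have "finite I"
  proof (rule ccontr)
    assume "infinite I"
    then have "?f A = \<infinity>" using energy_infinite[OF \<epsilon> \<tau> J(1)] I by simp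
    then show False using le'[OF J(1)] energy_finite[OF \<epsilon> \<tau> J J(1)] by simp
  qed
  moreover have "step_energy (\<epsilon> / \<tau>) J I \<le> step_energy (\<epsilon> / \<tau>) J I'" if "finite I'" "J \<subseteq> I'" for I'
    using le'[OF that] e2 unfolding I(1) energy_finite[OF \<epsilon> \<tau> J \<open>finite I\<close> I(2)] energy_finite[OF \<epsilon> \<tau> J that]
    by simp
  ultimately show ?R using I by (auto simp: minimal_step_def)
next
  have e2: "\<epsilon>\<^sup>2 > 0" using \<epsilon> by simp
  assume ?R
  then obtain I where I: "A = cells \<epsilon> I" "finite I" "J \<subseteq> I"
    and min: "\<And>I'. finite I' \<Longrightarrow> J \<subseteq> I' \<Longrightarrow> step_energy (\<epsilon> / \<tau>) J I \<le> step_energy (\<epsilon> / \<tau>) J I'"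
    by (auto simp: minimal_step_def)
  have "?f A \<le> ?f B" if B: "?P B" for B
  proof -
    obtain I' where I': "B = cells \<epsilon> I'" "J \<subseteq> I'"
      using B cells_subset_iff[OF \<epsilon>] by (auto simp: discrete_sets_eq)
    show ?thesis
    proof (cases "finite I'")
      case True
      then show ?thesis using min[OF True I'(2)] e2
        by (simp add: I(1) I'(1) energy_finite[OF \<epsilon> \<tau> J I(2,3)] energy_finite[OF \<epsilon> \<tau> J True I'(2)])
    next
      case False
      then show ?thesis using energy_infinite[OF \<epsilon> \<tau> J(1) _ I'(2)] I'(1) by simp
    qed
  qed
  moreover have "?P A"
    using I cells_subset_iff[OF \<epsilon>] finite_perimeter_cells[OF \<epsilon>] by (auto simp: discrete_sets_eq)
  ultimately show "is_arg_min ?f ?P A" by (auto simp: is_arg_min_def not_less)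
qed

end

section \<open>Minimal steps\<close>

text \<open>A boundary pair of \<open>I\<close> that starts in \<open>I'\<close> is already one of
  \<open>I'\<close>; the others start in a removed cell, which has four sides.\<close>

lemma card_boundary_pairs_le_Diff:
  assumes "finite I" "I' \<subseteq> I"
  shows "card (boundary_pairs I) \<le> card (boundary_pairs I') + 4 * card (I - I')"
proof -
  have "boundary_pairs I \<subseteq> boundary_pairs I' \<union> (I - I') \<times> dirs"
    using assms(2) by (auto simp: boundary_pairs_def)
  then have "card (boundary_pairs I) \<le> card (boundary_pairs I' \<union> (I - I') \<times> dirs)"
    using assms by (intro card_mono) (auto intro: finite_boundary_pairs finite_subset)
  also have "\<dots> \<le> card (boundary_pairs I') + card ((I - I') \<times> dirs)" by (rule card_Un_le)
  finally show ?thesis by (simp add: card_cartesian_product card_dirs)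
qed

text \<open>The new cell shares no side with \<open>I\<close>, so no old edge is lost and all four
  of its sides are gained.\<close>

lemma card_boundary_pairs_insert:
  assumes "finite I" "q \<notin> I" "\<And>e. e \<in> dirs \<Longrightarrow> q + e \<notin> I"
  shows "card (boundary_pairs I) + 4 \<le> card (boundary_pairs (insert q I))"
proof -
  have neg: "- e \<in> dirs" if "e \<in> dirs" for e using that by (auto simp: dirs_def)
  have "i + e \<noteq> q" if "i \<in> I" "e \<in> dirs" for i e
    using assms(3)[OF neg[OF that(2)]] that(1) by auto
  moreover have "q + e \<noteq> q" if "e \<in> dirs" for e using that by (auto simp: dirs_def zero_prod_def)
  ultimately have "(i, e) \<in> boundary_pairs (insert q I)"
    if "(i, e) \<in> boundary_pairs I \<union> {q} \<times> dirs" for i e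
    using that assms(3) unfolding boundary_pairs_def mem_Collect_eq case_prod_conv Un_iff mem_Sigma_iff
    by (elim disjE conjE) simp_all
  then have "boundary_pairs I \<union> {q} \<times> dirs \<subseteq> boundary_pairs (insert q I)" by (rule subrelI)
  then have "card (boundary_pairs I \<union> {q} \<times> dirs) \<le> card (boundary_pairs (insert q I))"
    using assms by (intro card_mono finite_boundary_pairs) auto
  moreover have "card (boundary_pairs I \<union> {q} \<times> dirs) = card (boundary_pairs I) + card ({q} \<times> dirs)"
  proof (intro card_Un_disjoint finite_boundary_pairs assms)
    show "boundary_pairs I \<inter> {q} \<times> dirs = {}" using assms(2) by (auto simp: boundary_pairs_def)
  qed simp
  ultimately show ?thesis by (simp add: card_cartesian_product card_dirs)
qed

text \<open>A neighbour of the origin contributes at most \<open>3 - 1\<close>, since the edge it shares with the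
  cell at the origin is lost as well.\<close>

lemma card_boundary_pairs_le_origin:
  assumes "finite I" "0 \<in> I"
  shows "card (boundary_pairs I) \<le> 4 + 2 * card (I \<inter> dirs) + 4 * card (I - insert 0 dirs)"
proof -
  let ?N = "I \<inter> dirs" and ?F = "I - insert 0 dirs"
  have neg: "- e \<in> dirs" if "e \<in> dirs" for e using that by (auto simp: dirs_def)
  have "boundary_pairs I \<subseteq> ({0} \<times> (dirs - I) \<union> (SIGMA i:?N. dirs - {- i})) \<union> ?F \<times> dirs"
    using assms(2) by (auto simp: boundary_pairs_def zero_prod_def)
  then have "card (boundary_pairs I) \<le> card (({0} \<times> (dirs - I) \<union> (SIGMA i:?N. dirs - {- i})) \<union> ?F \<times> dirs)"
    using assms by (intro card_mono) auto
  also have "\<dots> \<le> card ({0 :: int \<times> int} \<times> (dirs - I)) + card (SIGMA i:?N. dirs - {- i}) + card (?F \<times> dirs)"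
    by (intro order_trans[OF card_Un_le] add_mono card_Un_le order_refl)
  also have "card (SIGMA i:?N. dirs - {- i}) = (\<Sum>i\<in>?N. 3)"
    using neg by (subst card_SigmaI) (auto simp: card_dirs intro!: sum.cong)
  also have "card ({0 :: int \<times> int} \<times> (dirs - I)) = 4 - card ?N"
    by (simp add: card_cartesian_product card_Diff_subset_Int Int_commute card_dirs)
  \<comment> \<open>The subtraction \<open>4 - card ?N\<close> of natural numbers is exact only
    under this bound.\<close>
  also have "card ?N \<le> 4"
    using card_mono[of dirs ?N] by (simp add: card_dirs)
  then have "4 - card ?N + (\<Sum>i\<in>?N. 3) + card (?F \<times> dirs) = 4 + 2 * card ?N + 4 * card ?F"
    by (simp add: card_cartesian_product card_dirs)
  finally show ?thesis .
qed

context absolute_norm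
begin

lemma minimal_step_pinned:
  assumes \<alpha>: "\<alpha> > 4 / \<phi> (1, 1)" and min: "minimal_step \<alpha> {0} I"
  shows "I = {0}"
proof -
  let ?N = "I \<inter> dirs" and ?F = "I - insert 0 dirs"
  have I: "finite I" "0 \<in> I" and le: "step_energy \<alpha> {0} I \<le> step_energy \<alpha> {0} {0}"
    using min by (auto simp: minimal_step_def)
  have a: "\<alpha> * \<phi> (1, 1) > 4" using \<alpha> diag_pos by (simp add: field_simps)
  have "4 / \<phi> (1, 1) \<ge> 2" using diag_pos diag_le_2 by (simp add: field_simps)
  then have a2: "\<alpha> > 2" using \<alpha> by linarith
  have z: "0 \<notin> dirs" by (auto simp: dirs_def zero_prod_def)
  have "(\<Sum>i\<in>I - {0}. dist_to {0} i) = (\<Sum>i\<in>?N \<union> ?F. \<phi> (pt 1 i))"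
    using z by (intro sum.cong) (auto simp: dist_to_def)
  also have "\<dots> = (\<Sum>i\<in>?N. \<phi> (pt 1 i)) + (\<Sum>i\<in>?F. \<phi> (pt 1 i))"
    using I by (intro sum.union_disjoint) auto
  also have "(\<Sum>i\<in>?N. \<phi> (pt 1 i)) = card ?N" by (simp add: pt_dirs)
  finally have "(\<Sum>i\<in>I - {0}. dist_to {0} i) = card ?N + (\<Sum>i\<in>?F. \<phi> (pt 1 i))" .
  moreover have "(\<Sum>i\<in>?F. \<phi> (1, 1)) \<le> (\<Sum>i\<in>?F. \<phi> (pt 1 i))"
    by (intro sum_mono pt_ge_diag) auto
  ultimately have s: "(\<Sum>i\<in>I - {0}. dist_to {0} i) \<ge> card ?N + card ?F * \<phi> (1, 1)" by simp
  have bp0: "card (boundary_pairs {0}) = 4"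
  proof -
    have "boundary_pairs {0} = {0} \<times> dirs" using z by (auto simp: boundary_pairs_def)
    then show ?thesis by (simp add: card_cartesian_product card_dirs)
  qed
  have "real (card (boundary_pairs I)) \<le> real (4 + 2 * card ?N + 4 * card ?F)"
    using card_boundary_pairs_le_origin[OF I] by (rule of_nat_mono)
  moreover have "\<alpha> * (card ?N + card ?F * \<phi> (1, 1)) \<le> \<alpha> * (\<Sum>i\<in>I - {0}. dist_to {0} i)"
    using s a2 by (intro mult_left_mono) auto
  \<comment> \<open>The four edges of the nucleus cancel. Both weights are strictly positive, so the
    inequality forces both counts to vanish, which gives uniqueness of the minimizer.\<close>
  ultimately have "card ?N * (\<alpha> - 2) + card ?F * (\<alpha> * \<phi> (1, 1) - 4) \<le> 0"
    using le by (simp add: step_energy_def bp0 algebra_simps)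
  moreover have "card ?N * (\<alpha> - 2) \<ge> 0" "card ?F * (\<alpha> * \<phi> (1, 1) - 4) \<ge> 0" using a a2 by auto
  ultimately have "card ?N * (\<alpha> - 2) = 0" "card ?F * (\<alpha> * \<phi> (1, 1) - 4) = 0" by linarith+
  then have "?N = {}" "?F = {}" using I a a2 by auto
  then show ?thesis using I by auto
qed

section \<open>Bounded reach, existence of minimal steps, and their advance\<close>

lemma finite_norm_ball: "finite {i. \<phi> (pt 1 (i - j)) \<le> r}"
proof (rule finite_subset)
  show "{i. \<phi> (pt 1 (i - j)) \<le> r} \<subseteq>
      {k. \<bar>of_int (fst j) - 1 * of_int k\<bar> \<le> r} \<times> {k. \<bar>of_int (snd j) - 1 * of_int k\<bar> \<le> r}"
  proof
    fix i assume "i \<in> {i. \<phi> (pt 1 (i - j)) \<le> r}"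
    then have "\<bar>fst (pt 1 (i - j))\<bar> \<le> r" "\<bar>snd (pt 1 (i - j))\<bar> \<le> r"
      using ge_abs_fst[of "pt 1 (i - j)"] ge_abs_snd[of "pt 1 (i - j)"] by auto
    then show "i \<in> {k. \<bar>of_int (fst j) - 1 * of_int k\<bar> \<le> r} \<times> {k. \<bar>of_int (snd j) - 1 * of_int k\<bar> \<le> r}"
      by (auto simp: pt_def mem_Times_iff abs_minus_commute)
  qed
  show "finite ({k::int. \<bar>of_int (fst j) - 1 * of_int k\<bar> \<le> r} \<times> {k::int. \<bar>of_int (snd j) - 1 * of_int k\<bar> \<le> r})"
    by (intro finite_cartesian_product finite_near_multiples) auto
qed

text \<open>The radius \<open>4 / \<alpha>\<close> is the break-even distance: a cell that far away
  costs 4, the largest number of edges it can add.\<close>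

definition reach :: "real \<Rightarrow> (int \<times> int) set \<Rightarrow> (int \<times> int) set" where
  "reach \<alpha> J = (\<Union>j\<in>J. {i. \<phi> (pt 1 (i - j)) \<le> 4 / \<alpha>})"

lemma subset_reach: "\<alpha> > 0 \<Longrightarrow> J \<subseteq> reach \<alpha> J"
  unfolding reach_def using axis(1)[of 0] by (auto simp: pt_def)

lemma finite_reach: "finite J \<Longrightarrow> finite (reach \<alpha> J)"
  unfolding reach_def using finite_norm_ball by blast

text \<open>Removing a cell beyond reach destroys at most four edges but saves more than four.\<close>

lemma step_energy_Int_reach:
  assumes \<alpha>: "\<alpha> > 0" and J: "finite J" "J \<noteq> {}" and I: "finite I" "J \<subseteq> I"
  shows "step_energy \<alpha> J (I \<inter> reach \<alpha> J) \<le> step_energy \<alpha> J I"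
    and "\<not> I \<subseteq> reach \<alpha> J \<Longrightarrow> step_energy \<alpha> J (I \<inter> reach \<alpha> J) < step_energy \<alpha> J I"
proof -
  let ?R = "reach \<alpha> J"
  have JR: "J \<subseteq> ?R" by (rule subset_reach[OF \<alpha>])
  have far: "4 / \<alpha> < dist_to J i" if "i \<notin> ?R" for i
    by (rule dist_to_attained[OF J, of i]) (use that in \<open>auto simp: reach_def not_le\<close>)
  have "(\<Sum>i\<in>I - J. dist_to J i) = (\<Sum>i\<in>(I \<inter> ?R - J) \<union> (I - ?R). dist_to J i)"
    using JR by (intro sum.cong) auto
  also have "\<dots> = (\<Sum>i\<in>I \<inter> ?R - J. dist_to J i) + (\<Sum>i\<in>I - ?R. dist_to J i)"
    using I by (intro sum.union_disjoint) auto
  finally have s: "(\<Sum>i\<in>I - J. dist_to J i) = (\<Sum>i\<in>I \<inter> ?R - J. dist_to J i) + (\<Sum>i\<in>I - ?R. dist_to J i)" .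
  have eq: "I - I \<inter> ?R = I - ?R" by auto
  have "real (card (boundary_pairs I)) \<le> real (card (boundary_pairs (I \<inter> ?R)) + 4 * card (I - ?R))"
    using card_boundary_pairs_le_Diff[OF I(1), of "I \<inter> ?R"] unfolding eq by (intro of_nat_mono) auto
  then have *: "step_energy \<alpha> J (I \<inter> ?R) \<le> step_energy \<alpha> J I - (\<alpha> * (\<Sum>i\<in>I - ?R. dist_to J i) - 4 * card (I - ?R))"
    by (simp add: step_energy_def s algebra_simps)
  have c: "\<alpha> * (\<Sum>i\<in>I - ?R. 4 / \<alpha>) = 4 * card (I - ?R)" using \<alpha> by simp
  have "\<alpha> * (\<Sum>i\<in>I - ?R. 4 / \<alpha>) \<le> \<alpha> * (\<Sum>i\<in>I - ?R. dist_to J i)"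
    using \<alpha> far by (intro mult_left_mono sum_mono) (auto intro: less_imp_le)
  then show "step_energy \<alpha> J (I \<inter> ?R) \<le> step_energy \<alpha> J I" using * c by linarith
  assume "\<not> I \<subseteq> ?R"
  then have "\<alpha> * (\<Sum>i\<in>I - ?R. 4 / \<alpha>) < \<alpha> * (\<Sum>i\<in>I - ?R. dist_to J i)"
    using \<alpha> far I by (intro mult_strict_left_mono sum_strict_mono) auto
  then show "step_energy \<alpha> J (I \<inter> ?R) < step_energy \<alpha> J I" using * c by linarith
qed

text \<open>Truncating to the reach of \<open>J\<close> never raises the energy, so it suffices to
  minimize over the finitely many sets between \<open>J\<close> and its reach.\<close>

lemma ex_minimal_step:
  assumes \<alpha>: "\<alpha> > 0" and J: "finite J" "J \<noteq> {}"
  shows "\<exists>I. minimal_step \<alpha> J I"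
proof -
  have JR: "J \<subseteq> reach \<alpha> J" by (rule subset_reach[OF \<alpha>])
  let ?S = "{I. J \<subseteq> I \<and> I \<subseteq> reach \<alpha> J}"
  have "finite ?S" by (rule finite_subset[of _ "Pow (reach \<alpha> J)"]) (auto intro: finite_reach J)
  moreover have "?S \<noteq> {}" using JR by auto
  ultimately obtain I where I: "is_arg_min (step_energy \<alpha> J) (\<lambda>I. I \<in> ?S) I"
    using ex_is_arg_min_if_finite by blast
  have "step_energy \<alpha> J I \<le> step_energy \<alpha> J I'" if "finite I'" "J \<subseteq> I'" for I'
  proof -
    have "I' \<inter> reach \<alpha> J \<in> ?S" using that JR by auto
    then have "step_energy \<alpha> J I \<le> step_energy \<alpha> J (I' \<inter> reach \<alpha> J)"
      using I by (auto simp: is_arg_min_def not_less)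
    also have "\<dots> \<le> step_energy \<alpha> J I'" by (rule step_energy_Int_reach[OF \<alpha> J that])
    finally show ?thesis .
  qed
  moreover have "finite I" "J \<subseteq> I"
    using I finite_reach[OF J(1), of \<alpha>] by (auto simp: is_arg_min_def intro: finite_subset)
  ultimately show ?thesis by (auto simp: minimal_step_def)
qed

text \<open>Otherwise truncation would be strictly better. This is the source of finite propagation
  speed.\<close>

lemma minimal_step_subset_reach:
  assumes "\<alpha> > 0" "finite J" "J \<noteq> {}" "minimal_step \<alpha> J I"
  shows "I \<subseteq> reach \<alpha> J"
proof (rule ccontr)
  have JR: "J \<subseteq> reach \<alpha> J" by (rule subset_reach[OF assms(1)])
  assume "\<not> I \<subseteq> reach \<alpha> J"
  then have "step_energy \<alpha> J (I \<inter> reach \<alpha> J) < step_energy \<alpha> J I"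
    using assms by (intro step_energy_Int_reach) (auto simp: minimal_step_def)
  moreover have "step_energy \<alpha> J I \<le> step_energy \<alpha> J (I \<inter> reach \<alpha> J)"
    using assms(4) JR by (auto simp: minimal_step_def)
  ultimately show False by simp
qed

text \<open>If the step did not advance in the direction \<open>(1, 1)\<close>, adding the diagonal neighbour of an
  extremal point would create four edges at a cost of less than four.\<close>

lemma minimal_step_advances:
  assumes \<alpha>: "\<alpha> > 0" "\<alpha> < 4 / \<phi> (1, 1)" and J: "finite J"
    and min: "minimal_step \<alpha> J I" and j: "j \<in> J" "m \<le> fst j + snd j"
  shows "\<exists>i\<in>I. m + 1 \<le> fst i + snd i"
proof (rule ccontr)
  assume no: "\<not> ?thesis"
  have I: "finite I" "J \<subseteq> I" using min by (auto simp: minimal_step_def)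
  define q where "q = j + (1, 1)"
  have jm: "fst j + snd j = m" using no j I by force
  \<comment> \<open>By \<open>jm\<close> the site \<open>q\<close> has coordinate sum
    \<open>m + 2\<close>, so its neighbours have at least \<open>m + 1\<close>: none of them can be
    in \<open>I\<close>.\<close>
  have out: "i \<notin> I" if "m + 1 \<le> fst i + snd i" for i using no that by auto
  have q: "q \<notin> I" using jm by (intro out) (simp add: q_def)
  moreover have "q + e \<notin> I" if "e \<in> dirs" for e
    using jm that by (intro out) (auto simp: q_def dirs_def)
  ultimately have "real (card (boundary_pairs I) + 4) \<le> real (card (boundary_pairs (insert q I)))"
    using I by (intro of_nat_mono card_boundary_pairs_insert)
  moreover have "insert q I - J = insert q (I - J)" using q I by auto
  then have "(\<Sum>i\<in>insert q I - J. dist_to J i) = dist_to J q + (\<Sum>i\<in>I - J. dist_to J i)"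
    using q I by simp
  moreover have "dist_to J q \<le> \<phi> (1, 1)"
    using dist_to_le[OF J j(1), of q] by (simp add: q_def pt_def)
  then have "\<alpha> * dist_to J q \<le> \<alpha> * \<phi> (1, 1)" using \<alpha> by (intro mult_left_mono) auto
  moreover have "\<alpha> * \<phi> (1, 1) < 4" using \<alpha> diag_pos by (simp add: field_simps)
  ultimately have "step_energy \<alpha> J (insert q I) < step_energy \<alpha> J I"
    by (simp add: step_energy_def algebra_simps)
  moreover have "step_energy \<alpha> J I \<le> step_energy \<alpha> J (insert q I)"
    using min I by (auto simp: minimal_step_def)
  ultimately show False by simp
qed

section \<open>From the scheme to chains of index sets\<close>

lemma ex_minimal_chain:
  assumes "\<alpha> > 0"
  shows "\<exists>S. S 0 = {0} \<and> (\<forall>k. finite (S k) \<and> 0 \<in> S k \<and> minimal_step \<alpha> (S k) (S (Suc k)))"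
proof -
  have "\<exists>S. \<forall>k. (finite (S k) \<and> 0 \<in> S k \<and> (k = 0 \<longrightarrow> S k = {0})) \<and> minimal_step \<alpha> (S k) (S (Suc k))"
  proof (rule dependent_nat_choice)
    fix J :: "(int \<times> int) set" and k :: nat assume J: "finite J \<and> 0 \<in> J \<and> (k = 0 \<longrightarrow> J = {0})"
    then obtain I where "minimal_step \<alpha> J I" using ex_minimal_step[OF assms, of J] by auto
    then show "\<exists>I. (finite I \<and> 0 \<in> I \<and> (Suc k = 0 \<longrightarrow> I = {0})) \<and> minimal_step \<alpha> J I"
      using J by (auto simp: minimal_step_def)
  qed auto
  then show ?thesis by blast
qed

text \<open>The conditions on \<open>S\<close> do not mention \<tau>, so one chain of index sets,
  rescaled, solves the scheme for every time step.\<close>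

lemma discrete_solution_iff:
  assumes \<alpha>: "\<alpha> > 0" and \<tau>: "\<tau> > 0"
  shows "discrete_solution \<phi> (\<alpha> * \<tau>) \<tau> E \<longleftrightarrow>
    (\<exists>S. S 0 = {0} \<and> (\<forall>k. E k = cells (\<alpha> * \<tau>) (S k) \<and> finite (S k) \<and> minimal_step \<alpha> (S k) (S (Suc k))))"
    (is "?L \<longleftrightarrow> ?R")
proof
  have \<epsilon>: "\<alpha> * \<tau> > 0" and r: "\<alpha> * \<tau> / \<tau> = \<alpha>" using \<alpha> \<tau> by auto
  have cell0: "cell (\<alpha> * \<tau>) (0, 0) = cells (\<alpha> * \<tau>) {0}" by (simp add: cells_def pt_def)
  note am = is_arg_min_energy_iff[OF \<epsilon> \<tau>, unfolded r]
  have ne: "\<And>J I. minimal_step \<alpha> J I \<Longrightarrow> J \<noteq> {} \<Longrightarrow> I \<noteq> {}" by (auto simp: minimal_step_def)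
  {
    assume ?L
    then have E0: "E 0 = cells (\<alpha> * \<tau>) {0}"
      and step: "\<And>k. is_arg_min (\<lambda>A. energy \<phi> (\<alpha> * \<tau>) \<tau> A (E k))
        (\<lambda>A. A \<in> discrete_sets (\<alpha> * \<tau>) \<and> finite_perimeter A \<and> E k \<subseteq> A) (E (Suc k))"
      by (auto simp: discrete_solution_def cell0)
    have "\<exists>S. \<forall>k. (E k = cells (\<alpha> * \<tau>) (S k) \<and> finite (S k) \<and> S k \<noteq> {} \<and> (k = 0 \<longrightarrow> S k = {0})) \<and> minimal_step \<alpha> (S k) (S (Suc k))"
    proof (rule dependent_nat_choice)
      fix J and k :: nat assume J: "E k = cells (\<alpha> * \<tau>) J \<and> finite J \<and> J \<noteq> {} \<and> (k = 0 \<longrightarrow> J = {0})"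
      then obtain I where I: "E (Suc k) = cells (\<alpha> * \<tau>) I" "minimal_step \<alpha> J I"
        using step[of k] am[of J "E (Suc k)"] by auto
      moreover have "finite I" using I(2) by (simp add: minimal_step_def)
      ultimately show "\<exists>I. (E (Suc k) = cells (\<alpha> * \<tau>) I \<and> finite I \<and> I \<noteq> {} \<and> (Suc k = 0 \<longrightarrow> I = {0})) \<and> minimal_step \<alpha> J I"
        using J ne[OF I(2)] by blast
    qed (use E0 in auto)
    then obtain S where S: "\<And>k. (E k = cells (\<alpha> * \<tau>) (S k) \<and> finite (S k) \<and> S k \<noteq> {} \<and> (k = 0 \<longrightarrow> S k = {0})) \<and> minimal_step \<alpha> (S k) (S (Suc k))"
      by auto
    show ?R by (intro exI[of _ S]) (use S in simp)
  next
    assume ?R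
    then obtain S where S: "S 0 = {0}" "\<And>k. E k = cells (\<alpha> * \<tau>) (S k)" "\<And>k. finite (S k)"
      "\<And>k. minimal_step \<alpha> (S k) (S (Suc k))" by auto
    have "S k \<noteq> {}" for k
    proof (induction k)
      case (Suc k)
      then show ?case using ne[OF S(4)] by blast
    qed (simp add: S(1))
    then have "is_arg_min (\<lambda>A. energy \<phi> (\<alpha> * \<tau>) \<tau> A (E k))
        (\<lambda>A. A \<in> discrete_sets (\<alpha> * \<tau>) \<and> finite_perimeter A \<and> E k \<subseteq> A) (E (Suc k))" for k
      unfolding S(2)[of k] am[OF S(3) \<open>S k \<noteq> {}\<close>] using S(2,4) by blast
    then show ?L using S(1,2) by (simp add: discrete_solution_def cell0)
  }
qed

end

section \<open>Compactness in the Hausdorff distance\<close>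

lemma hausdorff_dist_le:
  assumes "\<And>x. x \<in> A \<Longrightarrow> \<exists>y\<in>B. dist x y \<le> r" "\<And>y. y \<in> B \<Longrightarrow> \<exists>x\<in>A. dist x y \<le> r"
  shows "hausdorff_dist A B \<le> ennreal r"
proof -
  have "(INF y\<in>B. ennreal (dist x y)) \<le> ennreal r" if x: "x \<in> A" for x
  proof -
    obtain y where "y \<in> B" "dist x y \<le> r" using assms(1)[OF x] by blast
    then show ?thesis by (intro INF_lower2[of y]) (auto intro: ennreal_leI)
  qed
  moreover have "(INF x\<in>A. ennreal (dist x y)) \<le> ennreal r" if y: "y \<in> B" for y
  proof -
    obtain x where "x \<in> A" "dist x y \<le> r" using assms(2)[OF y] by blast
    then show ?thesis by (intro INF_lower2[of x]) (auto intro: ennreal_leI)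
  qed
  ultimately show ?thesis unfolding hausdorff_dist_def by (intro max.boundedI SUP_least)
qed

lemma hausdorff_dist_lessD1:
  assumes "hausdorff_dist A B < ennreal r" "x \<in> A"
  shows "\<exists>y\<in>B. dist x y < r"
proof -
  have "(INF y\<in>B. ennreal (dist x y)) \<le> hausdorff_dist A B"
    unfolding hausdorff_dist_def using assms(2) by (intro max.coboundedI1 SUP_upper)
  then have "(INF y\<in>B. ennreal (dist x y)) < ennreal r" using assms(1) by (rule le_less_trans)
  then show ?thesis by (auto simp: INF_less_iff ennreal_less_iff)
qed

lemma hausdorff_dist_lessD2:
  assumes "hausdorff_dist A B < ennreal r" "y \<in> B"
  shows "\<exists>x\<in>A. dist x y < r"
proof -
  have "(INF x\<in>A. ennreal (dist x y)) \<le> hausdorff_dist A B"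
    unfolding hausdorff_dist_def using assms(2) by (intro max.coboundedI2 SUP_upper)
  then have "(INF x\<in>A. ennreal (dist x y)) < ennreal r" using assms(1) by (rule le_less_trans)
  then show ?thesis by (auto simp: INF_less_iff ennreal_less_iff)
qed

lemma tendsto_0_ennrealI:
  fixes f :: "'a \<Rightarrow> ennreal"
  assumes "\<And>e. e > 0 \<Longrightarrow> eventually (\<lambda>x. f x \<le> ennreal e) F"
  shows "(f \<longlongrightarrow> 0) F"
proof (rule order_tendstoI)
  fix a :: ennreal assume "0 < a"
  then obtain b where b: "0 < b" "b < a" using dense by blast
  then have "b \<noteq> top" using less_top by fastforce
  then obtain e where e: "b = ennreal e" "0 \<le> e" by (cases b) auto
  then have "e > 0" using b(1) by (simp add: ennreal_less_zero_iff)
  from assms[OF this] show "eventually (\<lambda>x. f x < a) F"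
    by eventually_elim (use e b in \<open>auto intro: le_less_trans\<close>)
qed simp

lemma infdist_lessE:
  assumes "A \<noteq> {}" "infdist x A < r"
  obtains a where "a \<in> A" "dist x a < r"
  using assms by (auto simp: infdist_notempty cINF_less_iff intro: bdd_belowI2[of _ 0])

lemma infdist_le_add:
  assumes "A \<noteq> {}" "\<And>a. a \<in> A \<Longrightarrow> \<exists>b\<in>B. dist a b \<le> c"
  shows "infdist z B \<le> infdist z A + c"
proof -
  have "infdist z B - c \<le> dist z a" if a: "a \<in> A" for a
  proof -
    obtain b where b: "b \<in> B" "dist a b \<le> c" using assms(2)[OF a] by blast
    have "infdist z B \<le> dist z b" using b(1) by (rule infdist_le)
    also have "\<dots> \<le> dist z a + dist a b" by (rule dist_triangle)
    finally show ?thesis using b(2) by linarith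
  qed
  then have "infdist z B - c \<le> infdist z A"
    unfolding infdist_notempty[OF assms(1)] using assms(1) by (intro cINF_greatest)
  then show ?thesis by simp
qed

text \<open>The limit \<open>f\<close> acts as the distance to its zero set: near-minimizers of the
  distance to \<open>A n\<close> stay in a compact ball, and a cluster point of them is a zero of
  \<open>f\<close> at distance at most \<open>f x\<close>.\<close>

lemma infdist_lim_attained:
  fixes A :: "nat \<Rightarrow> 'a::euclidean_space set"
  assumes ne: "\<And>n. A n \<noteq> {}" and bd: "\<And>n. A n \<subseteq> cball 0 R"
    and lim: "\<And>x. (\<lambda>n. infdist x (A n)) \<longlonglongrightarrow> f x"
  obtains y where "f y = 0" "y \<in> cball 0 R" "dist x y \<le> f x"
proof -
  have "\<exists>y\<in>A n. dist x y < infdist x (A n) + inverse (Suc n)" for n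
    by (rule infdist_lessE[OF ne[of n], of x "infdist x (A n) + inverse (Suc n)"]) auto
  then obtain y where y: "\<And>n. y n \<in> A n" "\<And>n. dist x (y n) < infdist x (A n) + inverse (Suc n)"
    by metis
  have "\<forall>n. y n \<in> cball 0 R" using y(1) bd by blast
  then obtain l r where l: "l \<in> cball 0 R" "strict_mono r" "(y \<circ> r) \<longlonglongrightarrow> l"
    using compact_cball[of "0 :: 'a" R] unfolding compact_def by blast
  have sub: "(\<lambda>n. infdist z (A (r n))) \<longlonglongrightarrow> f z" for z
    using LIMSEQ_subseq_LIMSEQ[OF lim l(2)] by (simp add: o_def)
  have d: "(\<lambda>n. dist z (y (r n))) \<longlonglongrightarrow> dist z l" for z
    using l(3) by (auto intro!: tendsto_intros simp: o_def)
  have "f l \<le> dist l l"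
    by (rule LIMSEQ_le[OF sub d]) (auto intro!: infdist_le y(1))
  moreover have "0 \<le> f l"
    by (rule LIMSEQ_le_const[OF lim]) (auto intro: infdist_nonneg)
  ultimately have "f l = 0" by simp
  moreover have "(\<lambda>n. inverse (real (Suc (r n)))) \<longlonglongrightarrow> 0"
    using LIMSEQ_subseq_LIMSEQ[OF LIMSEQ_inverse_real_of_nat l(2)] by (simp add: o_def)
  then have "(\<lambda>n. infdist x (A (r n)) + inverse (Suc (r n))) \<longlonglongrightarrow> f x + 0"
    by (intro tendsto_add sub)
  then have "dist x l \<le> f x + 0"
    by (rule LIMSEQ_le[OF d]) (use y(2) in \<open>auto intro: less_imp_le\<close>)
  ultimately show ?thesis using l(1) that by auto
qed

text \<open>Distance functions are 1-Lipschitz, so pointwise convergence is uniform on the ball, and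
  the zero set of \<open>f\<close> is the Hausdorff limit. Density of \<open>D\<close> in it
  suffices.\<close>

lemma hausdorff_dist_tendsto_0:
  fixes A :: "nat \<Rightarrow> 'a::euclidean_space set"
  assumes ne: "\<And>n. A n \<noteq> {}" and bd: "\<And>n. A n \<subseteq> cball 0 R"
    and lim: "\<And>x. (\<lambda>n. infdist x (A n)) \<longlonglongrightarrow> f x"
    and D: "D \<subseteq> {x. f x = 0}" "{x. f x = 0} \<subseteq> closure D"
  shows "(\<lambda>n. hausdorff_dist (A n) D) \<longlonglongrightarrow> 0"
proof (rule tendsto_0_ennrealI)
  fix e :: real assume e: "e > 0"
  have lip: "\<bar>f x - f y\<bar> \<le> dist x y" for x y
  proof (rule LIMSEQ_le_const2)
    show "(\<lambda>n. \<bar>infdist x (A n) - infdist y (A n)\<bar>) \<longlonglongrightarrow> \<bar>f x - f y\<bar>"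
      by (intro tendsto_intros lim)
  qed (auto intro: infdist_triangle_abs)
  have "cball (0::'a) R \<subseteq> (\<Union>z\<in>cball 0 R. ball z (e / 12))" using e by force
  then obtain N where N: "finite N" "cball (0::'a) R \<subseteq> (\<Union>z\<in>N. ball z (e / 12))"
    by (rule compactE_image[OF compact_cball open_ball])
  have "eventually (\<lambda>n. \<forall>z\<in>N. dist (infdist z (A n)) (f z) < e / 12) sequentially"
    using e lim by (intro eventually_ball_finite N ballI tendstoD) auto
  then show "eventually (\<lambda>n. hausdorff_dist (A n) D \<le> ennreal e) sequentially"
  proof eventually_elim
    case (elim n)
    \<comment> \<open>Three errors of \<open>e / 12\<close>: moving to the net point for
      \<open>A n\<close>, convergence there, and moving back for \<open>f\<close>.\<close>
    have close: "\<bar>infdist x (A n) - f x\<bar> < e / 4" if x: "x \<in> cball 0 R" for x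
    proof -
      obtain z where z: "z \<in> N" "dist z x < e / 12" using N x by fastforce
      have "\<bar>infdist z (A n) - f z\<bar> < e / 12" using elim z by (auto simp: dist_real_def)
      moreover have "\<bar>infdist z (A n) - infdist x (A n)\<bar> \<le> dist z x" by (rule infdist_triangle_abs)
      moreover have "\<bar>f z - f x\<bar> \<le> dist z x" by (rule lip)
      ultimately show ?thesis using z(2) by linarith
    qed
    show ?case
    proof (rule hausdorff_dist_le)
      fix x assume x: "x \<in> A n"
      then have "f x < e / 4" using close[of x] bd[of n] by auto
      moreover obtain y where y: "f y = 0" "dist x y \<le> f x"
        by (rule infdist_lim_attained[OF ne bd lim])
      then have "y \<in> closure D" using D by auto
      then obtain d where "d \<in> D" "dist d y < e / 4"
        using e by (auto simp: closure_approachable dest: spec[of _ "e / 4"])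
      moreover have "dist x d \<le> dist x y + dist d y" by (metis dist_triangle dist_commute)
      ultimately show "\<exists>y\<in>D. dist x y \<le> e" using y(2) e by (intro bexI[of _ d]) auto
    next
      fix y assume y: "y \<in> D"
      then have fy: "f y = 0" using D by auto
      obtain y' where y': "y' \<in> cball 0 R" "dist y y' \<le> f y"
        by (rule infdist_lim_attained[OF ne bd lim])
      then have "y \<in> cball 0 R" using fy by simp
      then have "infdist y (A n) < e" using close[of y] fy e by auto
      then obtain x where "x \<in> A n" "dist y x < e" using infdist_lessE[OF ne] by blast
      then show "\<exists>x\<in>A n. dist x y \<le> e" by (auto simp: dist_commute intro: less_imp_le)
    qed
  qed
qed

text \<open>Diagonal extraction works on countably many pairs of a rational time and a point. Other
  points follow from the Lipschitz property of distances, other times from monotonicity and the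
  speed bound, so no further subsequence depends on the time.\<close>

lemma infdist_convergent_subseq:
  fixes A :: "nat \<Rightarrow> real \<Rightarrow> 'a::euclidean_space set"
  assumes mono: "\<And>n s t. 0 \<le> s \<Longrightarrow> s \<le> t \<Longrightarrow> A n s \<subseteq> A n t"
    and zero: "\<And>n t. 0 \<le> t \<Longrightarrow> 0 \<in> A n t"
    and lip: "\<And>n s t x. 0 \<le> s \<Longrightarrow> s \<le> t \<Longrightarrow> x \<in> A n t \<Longrightarrow> \<exists>y\<in>A n s. dist x y \<le> C * (t - s) + \<eta> n"
    and \<eta>: "\<eta> \<longlonglongrightarrow> 0" and C: "C \<ge> 0"
  shows "\<exists>r. strict_mono r \<and> (\<forall>t\<ge>0. \<forall>x. convergent (\<lambda>n. infdist x (A (r n) t)))"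
proof -
  obtain Q :: "'a set" where Q: "countable Q" "\<And>X. open X \<Longrightarrow> X \<noteq> {} \<Longrightarrow> \<exists>d\<in>Q. d \<in> X"
    using countable_dense_setE by metis
  define S where "S = {t \<in> \<rat>. 0 \<le> (t::real)} \<times> Q"
  \<comment> \<open>All sets contain the origin, so this normalization is bounded by 1, as the
    extraction demands one bound for all pairs.\<close>
  define g where "g n z = infdist (snd z) (A n (fst z)) / (1 + norm (snd z))" for n and z :: "real \<times> 'a"
  have "countable S" unfolding S_def using Q(1) by (intro countable_SIGMA) (auto intro: countable_subset[OF _ countable_rat])
  moreover have "norm (g n z) \<le> 1" if "z \<in> S" for n z
  proof -
    have "infdist (snd z) (A n (fst z)) \<le> dist (snd z) 0"
      using that zero by (intro infdist_le) (auto simp: S_def)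
    then show ?thesis by (auto simp: g_def infdist_nonneg divide_simps add_pos_nonneg)
  qed
  ultimately obtain r where r: "strict_mono r" "\<And>z. z \<in> S \<Longrightarrow> \<exists>l. (\<lambda>n. g (r n) z) \<longlonglongrightarrow> l"
    using function_convergent_subsequence[of S g 1] by metis
  have "Cauchy (\<lambda>n. infdist x (A (r n) t))" if t: "t \<ge> 0" for t x
  proof (rule metric_CauchyI)
    fix e :: real assume e: "e > 0"
    \<comment> \<open>Adding 1 avoids division by zero when \<open>C = 0\<close>.\<close>
    define c where "c = C + 1"
    have c: "c > 0" "C \<le> c" using C by (auto simp: c_def)
    obtain s where s: "s \<in> \<rat>" "t < s" "s < t + e / (12 * c)"
      using Rats_dense_in_real[of t "t + e / (12 * c)"] e c by auto
    have "C * (s - t) \<le> c * (s - t)" using s c by (intro mult_right_mono) auto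
    also have "\<dots> \<le> c * (e / (12 * c))" using s c by (intro mult_left_mono) auto
    also have "\<dots> = e / 12" using c by simp
    finally have Cs: "C * (s - t) \<le> e / 12" .
    obtain z where z: "z \<in> Q" "dist x z < e / 12"
      using Q(2)[of "ball x (e / 12)"] e by auto
    have sz: "(s, z) \<in> S" using s t z by (auto simp: S_def)
    obtain l where l: "(\<lambda>n. g (r n) (s, z)) \<longlonglongrightarrow> l" using r(2)[OF sz] by blast
    have p: "1 + norm z \<noteq> 0" using norm_ge_zero[of z] by linarith
    have "(\<lambda>n. g (r n) (s, z) * (1 + norm z)) \<longlonglongrightarrow> l * (1 + norm z)"
      by (intro tendsto_mult l tendsto_const)
    then have "Cauchy (\<lambda>n. infdist z (A (r n) s))"
      using p by (intro LIMSEQ_imp_Cauchy[of _ "l * (1 + norm z)"]) (simp add: g_def)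
    then obtain M1 where M1: "\<And>m n. m \<ge> M1 \<Longrightarrow> n \<ge> M1 \<Longrightarrow>
        dist (infdist z (A (r m) s)) (infdist z (A (r n) s)) < e / 4"
      using e unfolding Cauchy_def by (metis divide_pos_pos zero_less_numeral)
    have "(\<lambda>n. \<eta> (r n)) \<longlonglongrightarrow> 0" using LIMSEQ_subseq_LIMSEQ[OF \<eta> r(1)] by (simp add: o_def)
    then have "eventually (\<lambda>n. dist (\<eta> (r n)) 0 < e / 12) sequentially" using e by (intro tendstoD) auto
    then obtain M2 where M2: "\<And>n. n \<ge> M2 \<Longrightarrow> \<bar>\<eta> (r n)\<bar> < e / 12"
      by (auto simp: eventually_sequentially dist_real_def)
    \<comment> \<open>Speed bound, vanishing error and change of point each contribute at most
      \<open>e / 12\<close>.\<close>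
    have near: "\<bar>infdist x (A (r n) t) - infdist z (A (r n) s)\<bar> < e / 4" if "n \<ge> M2" for n
    proof -
      have ne: "A (r n) t \<noteq> {}" "A (r n) s \<noteq> {}" using zero[of t "r n"] zero[of s "r n"] t s by auto
      have "infdist x (A (r n) s) \<le> infdist x (A (r n) t)"
        using mono[of t s "r n"] t s ne by (intro infdist_mono) auto
      moreover have "infdist x (A (r n) t) \<le> infdist x (A (r n) s) + (C * (s - t) + \<eta> (r n))"
        using lip[of t s _ "r n"] t s ne by (intro infdist_le_add) auto
      moreover have "\<bar>infdist x (A (r n) s) - infdist z (A (r n) s)\<bar> \<le> dist x z"
        by (rule infdist_triangle_abs)
      ultimately show ?thesis using M2[OF that] Cs z(2) by linarith
    qed
    have "dist (infdist x (A (r m) t)) (infdist x (A (r n) t)) < e" if "m \<ge> max M1 M2" "n \<ge> max M1 M2" for m n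
    proof -
      have "m \<ge> M1" "m \<ge> M2" "n \<ge> M1" "n \<ge> M2" using that by auto
      then show ?thesis using near[of m] near[of n] M1[of m n] unfolding dist_real_def by linarith
    qed
    then show "\<exists>M. \<forall>m\<ge>M. \<forall>n\<ge>M. dist (infdist x (A (r m) t)) (infdist x (A (r n) t)) < e" by blast
  qed
  then show ?thesis using r(1) by (auto intro: Cauchy_convergent)
qed

section \<open>Minimizing movements\<close>

context absolute_norm
begin

lemma norm_le_twice: "norm x \<le> 2 * \<phi> x"
  using norm_Pair_le[of "fst x" "snd x"] ge_abs_fst[of x] ge_abs_snd[of x] by simp

definition minimal_chain :: "real \<Rightarrow> (nat \<Rightarrow> (int \<times> int) set) \<Rightarrow> bool" where
  "minimal_chain \<alpha> S \<longleftrightarrow>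
     S 0 = {0} \<and> (\<forall>k. finite (S k) \<and> 0 \<in> S k \<and> minimal_step \<alpha> (S k) (S (Suc k)))"

lemma minimal_chain_mono: "minimal_chain \<alpha> S \<Longrightarrow> k \<le> l \<Longrightarrow> S k \<subseteq> S l"
  by (rule lift_Suc_mono_le) (auto simp: minimal_chain_def minimal_step_def)

text \<open>One step covers at most \<open>4 / \<alpha>\<close> in \<phi>, hence at most twice that
  in the Euclidean norm.\<close>

lemma minimal_chain_speed:
  assumes \<alpha>: "\<alpha> > 0" and S: "minimal_chain \<alpha> S" and i: "i \<in> S (k + m)"
  shows "\<exists>j\<in>S k. norm (pt 1 (i - j)) \<le> m * (8 / \<alpha>)"
  using i
proof (induction m arbitrary: i)
  case 0
  then show ?case by (intro bexI[of _ i]) (auto simp: pt_def)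
next
  case (Suc m)
  have st: "finite (S (k + m))" "S (k + m) \<noteq> {}" "minimal_step \<alpha> (S (k + m)) (S (Suc (k + m)))"
    using S unfolding minimal_chain_def by blast+
  have "i \<in> reach \<alpha> (S (k + m))"
    using minimal_step_subset_reach[OF \<alpha> st] Suc.prems by auto
  then obtain j where j: "j \<in> S (k + m)" "\<phi> (pt 1 (i - j)) \<le> 4 / \<alpha>" by (auto simp: reach_def)
  obtain l where l: "l \<in> S k" "norm (pt 1 (j - l)) \<le> m * (8 / \<alpha>)" using Suc.IH[OF j(1)] by blast
  have "pt 1 (i - l) = pt 1 (i - j) + pt 1 (j - l)" by (simp add: pt_def)
  then have "norm (pt 1 (i - l)) \<le> norm (pt 1 (i - j)) + norm (pt 1 (j - l))"
    by (simp add: norm_triangle_ineq)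
  also have "\<dots> \<le> 8 / \<alpha> + m * (8 / \<alpha>)"
    using norm_le_twice[of "pt 1 (i - j)"] j(2) l(2) by (intro add_mono) auto
  finally show ?case using l(1) by (intro bexI[of _ l]) (auto simp: algebra_simps add_divide_distrib)
qed

lemma minimal_chain_advances:
  assumes \<alpha>: "\<alpha> > 0" "\<alpha> < 4 / \<phi> (1, 1)" and S: "minimal_chain \<alpha> S"
  shows "\<exists>i\<in>S k. int k \<le> fst i + snd i"
proof (induction k)
  case (Suc k)
  then obtain j where j: "j \<in> S k" "int k \<le> fst j + snd j" by blast
  have "finite (S k)" "minimal_step \<alpha> (S k) (S (Suc k))" using S unfolding minimal_chain_def by blast+
  from minimal_step_advances[OF \<alpha> this j] show ?case by (simp add: add.commute)
qed (use S in \<open>simp add: minimal_chain_def\<close>)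

lemma discrete_solution_of_chain:
  "\<alpha> > 0 \<Longrightarrow> \<tau> > 0 \<Longrightarrow> minimal_chain \<alpha> S \<Longrightarrow> discrete_solution \<phi> (\<alpha> * \<tau>) \<tau> (\<lambda>k. cells (\<alpha> * \<tau>) (S k))"
  unfolding discrete_solution_iff minimal_chain_def by (intro exI[of _ S]) simp

text \<open>Between the two times there are at most \<open>(t - s) / \<tau> + 1\<close> steps, each
  of length at most \<open>\<alpha> * \<tau> * (8 / \<alpha>) = 8 * \<tau>\<close>. The extra
  \<open>8 * \<tau>\<close> comes from rounding the times.\<close>

lemma cells_speed:
  assumes \<alpha>: "\<alpha> > 0" and \<tau>: "\<tau> > 0" and S: "minimal_chain \<alpha> S" and st: "0 \<le> s" "s \<le> t"
    and x: "x \<in> cells (\<alpha> * \<tau>) (S (nat \<lfloor>t / \<tau>\<rfloor>))"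
  shows "\<exists>y\<in>cells (\<alpha> * \<tau>) (S (nat \<lfloor>s / \<tau>\<rfloor>)). dist x y \<le> 8 * (t - s) + 8 * \<tau>"
proof -
  let ?\<epsilon> = "\<alpha> * \<tau>"
  define k m where "k = nat \<lfloor>s / \<tau>\<rfloor>" and "m = nat \<lfloor>t / \<tau>\<rfloor> - nat \<lfloor>s / \<tau>\<rfloor>"
  have "s / \<tau> \<le> t / \<tau>" using st \<tau> by (intro divide_right_mono) auto
  then have le: "nat \<lfloor>s / \<tau>\<rfloor> \<le> nat \<lfloor>t / \<tau>\<rfloor>" by (intro nat_mono floor_mono)
  then have km: "nat \<lfloor>t / \<tau>\<rfloor> = k + m" by (simp add: k_def m_def)
  have "0 \<le> s / \<tau>" "0 \<le> t / \<tau>" using st \<tau> by auto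
  then have "real (nat \<lfloor>t / \<tau>\<rfloor>) \<le> t / \<tau>" "s / \<tau> - 1 \<le> real (nat \<lfloor>s / \<tau>\<rfloor>)" by linarith+
  then have "real m \<le> t / \<tau> - s / \<tau> + 1" using le by (simp add: m_def of_nat_diff)
  then have "real m * \<tau> \<le> (t / \<tau> - s / \<tau> + 1) * \<tau>" using \<tau> by (intro mult_right_mono) auto
  also have "\<dots> = t - s + \<tau>" using \<tau> by (simp add: field_simps)
  finally have m: "real m * \<tau> \<le> t - s + \<tau>" .
  obtain i where i: "i \<in> S (k + m)" "x \<in> cell ?\<epsilon> (pt ?\<epsilon> i)" using x unfolding km by (auto simp: cells_def)
  obtain j where j: "j \<in> S k" "norm (pt 1 (i - j)) \<le> m * (8 / \<alpha>)"
    using minimal_chain_speed[OF \<alpha> S i(1)] by blast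
  \<comment> \<open>Translation by the lattice vector keeps the position of the point within its
    cell.\<close>
  define y where "y = x - ?\<epsilon> *\<^sub>R pt 1 (i - j)"
  have "y \<in> cell ?\<epsilon> (pt ?\<epsilon> j)" using i(2) unfolding mem_cell y_def by (simp add: pt_def algebra_simps)
  then have "y \<in> cells ?\<epsilon> (S k)" using j(1) by (auto simp: cells_def)
  moreover have "dist x y = ?\<epsilon> * norm (pt 1 (i - j))"
    using \<alpha> \<tau> by (simp add: y_def dist_norm)
  then have "dist x y \<le> ?\<epsilon> * (m * (8 / \<alpha>))"
    using mult_left_mono[OF j(2), of ?\<epsilon>] \<alpha> \<tau> by simp
  then have "dist x y \<le> 8 * (m * \<tau>)" using \<alpha> by (simp add: field_simps)
  then have "dist x y \<le> 8 * (t - s) + 8 * \<tau>" using m by simp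
  ultimately show ?thesis by (auto simp: k_def)
qed

text \<open>The movement is obtained by compactness alone. Replacing the limit set by a countable dense
  subset does not change Hausdorff distances and makes its perimeter vanish.\<close>

lemma ex_nontrivial_movement:
  assumes \<alpha>: "\<alpha> > 0" "\<alpha> < 4 / \<phi> (1, 1)"
  shows "\<exists>X. minimizing_movement \<phi> \<alpha> X \<and> X 1 \<noteq> {(0, 0)}"
proof -
  obtain S where S: "minimal_chain \<alpha> S"
    using ex_minimal_chain[OF \<alpha>(1)] by (auto simp: minimal_chain_def)
  define \<tau> where "\<tau> n = inverse (real (Suc n))" for n
  have \<tau>: "\<tau> n > 0" "\<tau> n \<le> 1" for n by (auto simp: \<tau>_def field_simps)
  have \<tau>0: "\<tau> \<longlonglongrightarrow> 0" unfolding \<tau>_def by (rule LIMSEQ_inverse_real_of_nat)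
  \<comment> \<open>The same chain is used for every \<open>n\<close>; only its scaling in space and
    time changes.\<close>
  define A where "A n t = cells (\<alpha> * \<tau> n) (S (nat \<lfloor>t / \<tau> n\<rfloor>))" for n t
  have \<epsilon>: "\<alpha> * \<tau> n > 0" for n using \<alpha> \<tau> by simp
  have zero: "0 \<in> A n t" for n t
  proof -
    have "pt (\<alpha> * \<tau> n) 0 \<in> A n t"
      unfolding A_def pt_in_cells_iff[OF \<epsilon>] using S by (simp add: minimal_chain_def)
    then show ?thesis by (simp add: pt_def zero_prod_def)
  qed
  have mono: "A n s \<subseteq> A n t" if "0 \<le> s" "s \<le> t" for n s t
    unfolding A_def cells_subset_iff[OF \<epsilon>] using that less_imp_le[OF \<tau>(1)]
    by (intro minimal_chain_mono[OF S] nat_mono floor_mono divide_right_mono) auto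
  have speed: "\<exists>y\<in>A n s. dist x y \<le> 8 * (t - s) + 8 * \<tau> n" if "0 \<le> s" "s \<le> t" "x \<in> A n t" for n s t x
    using that unfolding A_def by (intro cells_speed \<alpha> \<tau> S)
  have "(\<lambda>n. 8 * \<tau> n) \<longlonglongrightarrow> 8 * 0" by (intro tendsto_intros \<tau>0)
  then obtain r where r: "strict_mono r" "\<And>t x. t \<ge> 0 \<Longrightarrow> convergent (\<lambda>n. infdist x (A (r n) t))"
    using infdist_convergent_subseq[of A 8 "\<lambda>n. 8 * \<tau> n", OF mono zero speed] by auto
  define f where "f t x = lim (\<lambda>n. infdist x (A (r n) t))" for t x
  have f: "(\<lambda>n. infdist x (A (r n) t)) \<longlonglongrightarrow> f t x" if "t \<ge> 0" for t x
    using r(2)[OF that] unfolding f_def convergent_LIMSEQ_iff .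
  have "\<exists>D. countable D \<and> D \<subseteq> {x. f t x = 0} \<and> {x. f t x = 0} \<subseteq> closure D" for t
    using separable[of "{x. f t x = 0}"] by metis
  then obtain X where X: "\<And>t. countable (X t)" "\<And>t. X t \<subseteq> {x. f t x = 0}" "\<And>t. {x. f t x = 0} \<subseteq> closure (X t)"
    by metis
  \<comment> \<open>The speed bound from time 0 with \<tau> at most 1, plus a radius for the initial
    cell; the bound is uniform in \<open>n\<close>, as compactness needs.\<close>
  have bd: "A n t \<subseteq> cball 0 (8 * t + 8 + \<alpha>)" if t: "t \<ge> 0" for n t
  proof
    fix x assume "x \<in> A n t"
    then obtain y where y: "y \<in> A n 0" "dist x y \<le> 8 * (t - 0) + 8 * \<tau> n" using speed[of 0 t x n] t by auto
    have "y \<in> cell (\<alpha> * \<tau> n) (pt (\<alpha> * \<tau> n) 0)"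
      using y(1) S by (simp add: A_def minimal_chain_def cells_def)
    then have "\<bar>fst y\<bar> \<le> \<alpha> * \<tau> n / 2" "\<bar>snd y\<bar> \<le> \<alpha> * \<tau> n / 2" by (simp_all add: mem_cell)
    then have "norm y \<le> \<alpha> * \<tau> n" using norm_Pair_le[of "fst y" "snd y"] by simp
    also have "\<dots> \<le> \<alpha>" using \<alpha>(1) \<tau>(2)[of n] by simp
    finally have "dist x 0 \<le> 8 * t + 8 * \<tau> n + \<alpha>" using y(2) dist_triangle[of x 0 y] by simp
    then show "x \<in> cball 0 (8 * t + 8 + \<alpha>)" using \<tau>(2)[of n] by simp
  qed
  have conv: "(\<lambda>n. hausdorff_dist (A (r n) t) (X t)) \<longlonglongrightarrow> 0" if t: "t \<ge> 0" for t
  proof (rule hausdorff_dist_tendsto_0[OF _ _ f[OF t] X(2,3)])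
    show "A (r n) t \<noteq> {}" for n using zero by blast
    show "A (r n) t \<subseteq> cball 0 (8 * t + 8 + \<alpha>)" for n by (rule bd[OF t])
  qed
  have \<tau>r: "(\<lambda>n. \<tau> (r n)) \<longlonglongrightarrow> 0" using LIMSEQ_subseq_LIMSEQ[OF \<tau>0 r(1)] by (simp add: o_def)
  have "minimizing_movement \<phi> \<alpha> X"
    unfolding minimizing_movement_def
  proof (intro conjI allI impI exI[of _ "\<lambda>n. \<tau> (r n)"] exI[of _ "\<lambda>n k. cells (\<alpha> * \<tau> (r n)) (S k)"])
    show "finite_perimeter (X t)" for t by (rule finite_perimeter_countable[OF X(1)])
    show "discrete_solution \<phi> (\<alpha> * \<tau> (r n)) (\<tau> (r n)) (\<lambda>k. cells (\<alpha> * \<tau> (r n)) (S k))" for n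
      by (rule discrete_solution_of_chain[OF \<alpha>(1) \<tau>(1) S])
    show "(\<lambda>n. hausdorff_dist (cells (\<alpha> * \<tau> (r n)) (S (nat \<lfloor>t / \<tau> (r n)\<rfloor>))) (X t)) \<longlonglongrightarrow> 0" if "t \<ge> 0" for t
      using conv[OF that] unfolding A_def .
  qed (use \<tau> \<tau>r in auto)
  moreover have "X 1 \<noteq> {(0, 0)}"
  proof
    assume X1: "X 1 = {(0, 0)}"
    \<comment> \<open>Being within \<open>\<alpha> / 8\<close> of the origin bounds the coordinate
      sum by \<open>\<alpha> / 4\<close>, whereas the advance of the chain gives at least
      \<open>\<alpha> - \<alpha> * \<tau>\<close>, so at least \<open>\<alpha> / 2\<close> once
      \<tau> is below 1/2.\<close>
    have "eventually (\<lambda>n. hausdorff_dist (A (r n) 1) (X 1) < ennreal (\<alpha> / 8)) sequentially"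
      using \<alpha>(1) by (intro order_tendstoD(2)[OF conv]) auto
    moreover have "eventually (\<lambda>n. \<tau> (r n) < 1 / 2) sequentially"
      by (intro order_tendstoD(2)[OF \<tau>r]) auto
    ultimately have "eventually (\<lambda>n. hausdorff_dist (A (r n) 1) (X 1) < ennreal (\<alpha> / 8) \<and> \<tau> (r n) < 1 / 2) sequentially"
      by (rule eventually_conj)
    then obtain n where n: "hausdorff_dist (A (r n) 1) (X 1) < ennreal (\<alpha> / 8)" "\<tau> (r n) < 1 / 2"
      by (auto simp: eventually_sequentially)
    define k where "k = nat \<lfloor>1 / \<tau> (r n)\<rfloor>"
    let ?\<epsilon> = "\<alpha> * \<tau> (r n)"
    obtain i where i: "i \<in> S k" "int k \<le> fst i + snd i" using minimal_chain_advances[OF \<alpha> S] by blast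
    have "pt ?\<epsilon> i \<in> A (r n) 1" unfolding A_def k_def[symmetric] pt_in_cells_iff[OF \<epsilon>] by (rule i)
    then have "dist (pt ?\<epsilon> i) (0, 0) < \<alpha> / 8" using hausdorff_dist_lessD1[OF n(1)] X1 by auto
    then have "\<bar>fst (pt ?\<epsilon> i)\<bar> < \<alpha> / 8" "\<bar>snd (pt ?\<epsilon> i)\<bar> < \<alpha> / 8"
      using norm_fst_le[of "fst (pt ?\<epsilon> i)" "snd (pt ?\<epsilon> i)"] norm_snd_le[of "snd (pt ?\<epsilon> i)" "fst (pt ?\<epsilon> i)"]
      by (auto simp: dist_norm zero_prod_def[symmetric])
    then have "fst (pt ?\<epsilon> i) + snd (pt ?\<epsilon> i) < \<alpha> / 4" by linarith
    then have "?\<epsilon> * of_int (fst i + snd i) < \<alpha> / 4" by (simp add: pt_def distrib_left)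
    moreover have "?\<epsilon> * k \<le> ?\<epsilon> * of_int (fst i + snd i)"
      using i(2) \<epsilon>[of "r n"] by (intro mult_left_mono) linarith+
    moreover have "\<alpha> / 2 \<le> ?\<epsilon> * k"
    proof -
      have "1 / \<tau> (r n) - 1 \<le> k" unfolding k_def by linarith
      then have "?\<epsilon> * (1 / \<tau> (r n) - 1) \<le> ?\<epsilon> * k" using \<epsilon>[of "r n"] by (intro mult_left_mono) auto
      moreover have "?\<epsilon> * (1 / \<tau> (r n) - 1) = \<alpha> - \<alpha> * \<tau> (r n)"
        using \<tau>(1)[of "r n"] by (simp add: field_simps)
      moreover have "\<alpha> * \<tau> (r n) \<le> \<alpha> * (1 / 2)" using n(2) \<alpha>(1) by (intro mult_left_mono) auto
      ultimately show ?thesis by simp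
    qed
    ultimately show False using \<alpha>(1) by linarith
  qed
  ultimately show ?thesis by blast
qed

text \<open>Every discrete solution is a single cell shrinking to the origin. The Hausdorff distance
  identifies sets with equal closure, but the origin alone is the closure of no other set, so the
  limit is exact.\<close>

lemma movement_pinned:
  assumes \<alpha>: "\<alpha> > 4 / \<phi> (1, 1)" and X: "minimizing_movement \<phi> \<alpha> X" and t: "t \<ge> 0"
  shows "X t = {(0, 0)}"
proof -
  have \<alpha>0: "\<alpha> > 0" using \<alpha> diag_pos by (meson divide_pos_pos less_trans zero_less_numeral)
  obtain \<tau> E where \<tau>: "\<And>n. \<tau> n > 0" "\<tau> \<longlonglongrightarrow> 0" and E: "\<And>n. discrete_solution \<phi> (\<alpha> * \<tau> n) (\<tau> n) (E n)"
    and lim: "(\<lambda>n. hausdorff_dist (E n (nat \<lfloor>t / \<tau> n\<rfloor>)) (X t)) \<longlonglongrightarrow> 0"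
    using X t unfolding minimizing_movement_def by blast
  have En: "E n k = cell (\<alpha> * \<tau> n) (pt (\<alpha> * \<tau> n) 0)" for n k
  proof -
    obtain S where S: "S 0 = {0}" "\<And>k. E n k = cells (\<alpha> * \<tau> n) (S k)" "\<And>k. minimal_step \<alpha> (S k) (S (Suc k))"
      using E[of n] unfolding discrete_solution_iff[OF \<alpha>0 \<tau>(1)] by auto
    have "S k = {0}"
    proof (induction k)
      case (Suc k)
      then show ?case using minimal_step_pinned[OF \<alpha>] S(3)[of k] by simp
    qed (rule S(1))
    then show ?thesis by (simp add: S(2) cells_def)
  qed
  have near: "\<exists>n. hausdorff_dist (cell (\<alpha> * \<tau> n) (pt (\<alpha> * \<tau> n) 0)) (X t) < ennreal e \<and> \<alpha> * \<tau> n < e" if e: "e > 0" for e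
  proof -
    have "(\<lambda>n. \<alpha> * \<tau> n) \<longlonglongrightarrow> \<alpha> * 0" by (intro tendsto_intros \<tau>(2))
    then have "eventually (\<lambda>n. \<alpha> * \<tau> n < e) sequentially" using e by (intro order_tendstoD(2)) auto
    moreover have "eventually (\<lambda>n. hausdorff_dist (E n (nat \<lfloor>t / \<tau> n\<rfloor>)) (X t) < ennreal e) sequentially"
      using e by (intro order_tendstoD(2)[OF lim]) auto
    ultimately have "eventually (\<lambda>n. \<alpha> * \<tau> n < e \<and> hausdorff_dist (E n (nat \<lfloor>t / \<tau> n\<rfloor>)) (X t) < ennreal e) sequentially"
      by (rule eventually_conj)
    then show ?thesis unfolding En by (auto simp: eventually_sequentially)
  qed
  have "y = (0, 0)" if y: "y \<in> X t" for y
  proof -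
    have "norm y \<le> 0 + e" if e: "e > 0" for e
    proof -
      obtain n where n: "hausdorff_dist (cell (\<alpha> * \<tau> n) (pt (\<alpha> * \<tau> n) 0)) (X t) < ennreal (e / 2)" "\<alpha> * \<tau> n < e / 2"
        using near[of "e / 2"] e by auto
      obtain x where x: "x \<in> cell (\<alpha> * \<tau> n) (pt (\<alpha> * \<tau> n) 0)" "dist x y < e / 2"
        using hausdorff_dist_lessD2[OF n(1) y] by blast
      then have "\<bar>fst x\<bar> \<le> \<alpha> * \<tau> n / 2" "\<bar>snd x\<bar> \<le> \<alpha> * \<tau> n / 2" by (simp_all add: mem_cell)
      then have "norm x \<le> \<alpha> * \<tau> n" using norm_Pair_le[of "fst x" "snd x"] by simp
      moreover have "norm y \<le> norm x + dist x y"
        using norm_triangle_ineq2[of y x] by (simp add: dist_norm norm_minus_commute)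
      ultimately show ?thesis using x(2) n(2) by linarith
    qed
    then have "norm y \<le> 0" by (rule field_le_epsilon)
    then show ?thesis by (simp add: zero_prod_def)
  qed
  \<comment> \<open>The empty set is at infinite distance from every cell.\<close>
  moreover have "X t \<noteq> {}"
  proof -
    obtain n where n: "hausdorff_dist (cell (\<alpha> * \<tau> n) (pt (\<alpha> * \<tau> n) 0)) (X t) < ennreal 1"
      using near[of 1] by auto
    have "pt (\<alpha> * \<tau> n) 0 \<in> cell (\<alpha> * \<tau> n) (pt (\<alpha> * \<tau> n) 0)"
      unfolding mem_cell using \<alpha>0 \<tau>(1)[of n] by (simp add: pt_def)
    then show ?thesis using hausdorff_dist_lessD1[OF n] by blast
  qed
  ultimately show ?thesis by blast
qed

lemma pinning_threshold_eq: "pinning_threshold \<phi> = 4 / \<phi> (1, 1)"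
proof -
  let ?c = "4 / \<phi> (1, 1)"
  define T where "T = {\<alpha>. \<alpha> > 0 \<and> (\<forall>X. minimizing_movement \<phi> \<alpha> X \<longrightarrow> (\<forall>t\<ge>0. X t = {(0, 0)}))}"
  have c: "?c > 0" using diag_pos by simp
  have in_T: "?c + e \<in> T" if "e > 0" for e
    unfolding T_def
  proof (intro CollectI conjI allI impI)
    show "?c + e > 0" using c that by linarith
    show "X t = {(0, 0)}" if "minimizing_movement \<phi> (?c + e) X" "t \<ge> 0" for X t
      using \<open>e > 0\<close> that by (intro movement_pinned[of "?c + e"]) auto
  qed
  have ge: "?c \<le> \<alpha>" if "\<alpha> \<in> T" for \<alpha>
  proof (rule ccontr)
    assume "\<not> ?c \<le> \<alpha>"
    moreover have T: "\<alpha> > 0" "\<And>X t. minimizing_movement \<phi> \<alpha> X \<Longrightarrow> t \<ge> 0 \<Longrightarrow> X t = {(0, 0)}"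
      using that unfolding T_def by auto
    ultimately obtain X where "minimizing_movement \<phi> \<alpha> X" "X 1 \<noteq> {(0, 0)}"
      using ex_nontrivial_movement[of \<alpha>] unfolding not_le by metis
    then show False using T(2)[of X 1] by simp
  qed
  have "Inf T \<le> ?c"
  proof (rule field_le_epsilon)
    show "Inf T \<le> ?c + e" if "e > 0" for e
      using in_T[OF that] ge by (intro cInf_lower bdd_belowI[of _ ?c])
  qed
  moreover have "?c \<le> Inf T" using in_T[of 1] ge by (intro cInf_greatest) auto
  ultimately show ?thesis unfolding pinning_threshold_def T_def by simp
qed

text \<open>The neighbours of the origin have odd coordinate sum, so \<open>pt_ge_diag\<close>
  applies to every nonzero even site.\<close>

lemma Lambda_max: "4 / \<phi> (1, 1) \<in> Lambda \<phi>" "l \<in> Lambda \<phi> \<Longrightarrow> l \<le> 4 / \<phi> (1, 1)"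
proof -
  show "4 / \<phi> (1, 1) \<in> Lambda \<phi>"
    unfolding Lambda_def by (intro CollectI exI[of _ 1]) auto
  assume "l \<in> Lambda \<phi>"
  then obtain i j where ij: "l = 4 / \<phi> (of_int i, of_int j)" "even (i + j)" "(i, j) \<noteq> (0, 0)"
    unfolding Lambda_def by blast
  have "\<phi> (1, 1) \<le> \<phi> (pt 1 (i, j))"
    using ij(2,3) by (intro pt_ge_diag) (auto simp: dirs_def zero_prod_def)
  then show "l \<le> 4 / \<phi> (1, 1)"
    unfolding ij(1) using diag_pos by (intro divide_left_mono) (auto simp: pt_def)
qed

end

theorem proposition41:
  fixes \<phi> :: "real \<times> real \<Rightarrow> real"
  assumes "is_norm \<phi>" and "symmetric \<phi>" and "absolute \<phi>" and "normalized \<phi>"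
  shows "pinning_threshold \<phi> = 4 / \<phi> (1, 1) \<and>
         4 / \<phi> (1, 1) \<in> Lambda \<phi> \<and> (\<forall>l\<in>Lambda \<phi>. l \<le> 4 / \<phi> (1, 1))"
proof -
  interpret absolute_norm \<phi> by (unfold_locales; fact)
  show ?thesis using pinning_threshold_eq Lambda_max by blast
qed

end
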